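(* Suppose that the operators $\Pi^\ell$ ($\ell=0,1,2,3$) satisfy the commuting diagram and translation invariance assumption and that the shape function $S$ is admissible (see context). For functionals $\mathcal F,\mathcal G$ on the state space $\mathcal U=(\mathbb R^3)^N\times(\mathbb R^3)^N\times V_h^2\times V_h^1$, with points $U=(\boldsymbol X,\boldsymbol V,\boldsymbol E_h,\boldsymbol B_h)$, $\boldsymbol X=(\boldsymbol X_p)_{p=1}^N$, $\boldsymbol V=(\boldsymbol V_p)_{p=1}^N$, define $$ \begin{aligned} \{\mathcal F,\mathcal G\}(U)=&\sum_{p=1}^N\Big[\frac1{m_p}\Big(\frac{\delta\mathcal F}{\delta \boldsymbol X_p}\cdot\frac{\delta\mathcal G}{\delta \boldsymbol V_p}-\frac{\delta\mathcal F}{\delta \boldsymbol V_p}\cdot\frac{\delta\mathcal G}{\delta \boldsymbol X_p}\Big)+\frac{q_p}{m_p^2}\,\boldsymbol B^S(\boldsymbol X_p)\cdot\Big(\frac{\delta\mathcal F}{\delta \boldsymbol V_p}\times\frac{\delta\mathcal G}{\delta \boldsymbol V_p}\Big)\\ &\quad+\frac{q_p}{m_p}\int_\Omega\Big(\Pi^2\Big(S_{\boldsymbol X_p}\frac{\delta\mathcal F}{\delta \boldsymbol V_p}\Big)\cdot\frac{\delta\mathcal G}{\delta \boldsymbol E_h}-\frac{\delta\mathcal F}{\delta \boldsymbol E_h}\cdot\Pi^2\Big(S_{\boldsymbol X_p}\frac{\delta\mathcal G}{\delta \boldsymbol V_p}\Big)\Big)\,d\boldsymbol x\Big]\\ &+\int_\Omega\Big(\frac{\delta\mathcal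 F}{\delta \boldsymbol E_h}\cdot\operatorname{curl}\frac{\delta\mathcal G}{\delta \boldsymbol B_h}-\operatorname{curl}\frac{\delta\mathcal F}{\delta \boldsymbol B_h}\cdot\frac{\delta\mathcal G}{\delta \boldsymbol E_h}\Big)\,d\boldsymbol x , \end{aligned} $$ all functional derivatives being evaluated at $U$. Then, for states satisfying the discrete magnetic Gauss law $\operatorname{div}_w\boldsymbol B_h=0$, this bracket is a (non-canonical) Poisson bracket. Moreover, the semi-discrete equations $$ \begin{cases} -\partial_t\boldsymbol E_h+\operatorname{curl}\boldsymbol B_h=\sum_{p=1}^Nq_p\,\Pi^2(\boldsymbol V_pS_{\boldsymbol X_p}),\\ \partial_t\boldsymbol B_h+\operatorname{curl}_w\boldsymbol E_h=0, \end{cases} \qquad \begin{cases} \frac{d\boldsymbol X_p}{dt}=\boldsymbol V_p,\\ \frac{d\boldsymbol V_p}{dt}=\frac{q_p}{m_p}\big(\boldsymbol E^S(\boldsymbol X_p)+\boldsymbol V_p\times\boldsymbol B^S(\boldsymbol X_p)\big), \end{cases}\quad p=1,\dots,N, $$ are a Poisson system for this bracket, namely $\frac{d}{dt}\mathcal F(U(t))=\{\mathcal F,\mathcal H\}(U(t))$ for every functional $\mathcal F$, with the Hamiltonian $$\mathcal H(U)=\sum_{p=1}^N\frac{m_p}{2}|\boldsymbol V_p|^2+\frac12\int_\Omega|\boldsymbol E_h|^2\,d\boldsymbol x+\frac12\int_\Omega|\boldsymbol B_h|^2\,d\boldsymbol x .$$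
   Context: **Discrete spaces.** $\Omega$ is the spatial domain. $V_h^0,V_h^1,V_h^2,V_h^3$ are finite-dimensional spaces of square-integrable functions on $\Omega$ (scalar for $\ell=0,3$, $\mathbb R^3$-valued for $\ell=1,2$) with $\operatorname{grad}V_h^0\subset V_h^1$, $\operatorname{curl}V_h^1\subset V_h^2$, $\operatorname{div}V_h^2\subset V_h^3$. **Weak operators.** $\operatorname{curl}_w:V_h^2\to V_h^1$ and $\operatorname{div}_w:V_h^1\to V_h^0$ are the discrete adjoints defined by $\int_\Omega(\operatorname{curl}_w\boldsymbol F_h)\cdot\boldsymbol C_h=\int_\Omega\boldsymbol F_h\cdot\operatorname{curl}\boldsymbol C_h$ and $\int_\Omega(\operatorname{div}_w\boldsymbol C_h)\psi_h=-\int_\Omega\boldsymbol C_h\cdot\operatorname{grad}\psi_h$ for all $\boldsymbol F_h\in V_h^2$, $\boldsymbol C_h\in V_h^1$, $\psi_h\in V_h^0$. **Assumption on $\Pi^\ell$.** $V^0,V^1,V^2,V^3$ are infinite-dimensional linear function (or distribution) spaces (scalar for $\ell=0,3$, vector-valued for $\ell=1,2$) with $\operatorname{grad}V^0\subset V^1$, $\operatorname{curl}V^1\subset V^2$, $\operatorname{div}V^2\subset V^3$, each translation invariant ($G\in V^\ell\Rightarrow G(\cdot-\boldsymbol x)\in V^\ell$ for all $\boldsymbol x\in\mathbb R^3$). $\Pi^\ell:V^\ell\to V_h^\ell$ are linear projection operators such that $\Pi^1\operatorname{grad}G=\operatorname{grad}\Pi^0G$ for $G\in V^0$, $\Pi^2\operatorname{curl}\boldsymbol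 G=\operatorname{curl}\Pi^1\boldsymbol G$ for $\boldsymbol G\in V^1$, $\Pi^3\operatorname{div}\boldsymbol G=\operatorname{div}\Pi^2\boldsymbol G$ for $\boldsymbol G\in V^2$. **Admissible shape function.** A shape function $S$ is admissible if $S\in V^0$, $S\in V^3$, and $\boldsymbol eS\in V^1$, $\boldsymbol eS\in V^2$ for every $\boldsymbol e\in\mathbb R^3$. Write $S_{\boldsymbol y}(\boldsymbol x)=S(\boldsymbol x-\boldsymbol y)$. **Particles and coupling fields.** $N$ is the number of particles, $m_p\neq0$ and $q_p$ are real constants (particle masses and charges multiplied by their weights). With $(\boldsymbol e_1,\boldsymbol e_2,\boldsymbol e_3)$ the canonical basis of $\mathbb R^3$, $$\boldsymbol E^S(\boldsymbol X_p)=\sum_{\alpha=1}^3\boldsymbol e_\alpha\int_\Omega\boldsymbol E_h\cdot\Pi^2(\boldsymbol e_\alpha S_{\boldsymbol X_p})\,d\boldsymbol x,\qquad \boldsymbol B^S(\boldsymbol X_p)=\sum_{\alpha=1}^3\boldsymbol e_\alpha\int_\Omega\boldsymbol B_h\cdot\Pi^1(\boldsymbol e_\alpha S_{\boldsymbol X_p})\,d\boldsymbol x .$$ **Functional derivatives.** Functionals are understood to be smooth. $\frac{\delta\mathcal F}{\delta\boldsymbol X_p},\frac{\delta\mathcal F}{\delta\boldsymbol V_p}\in\mathbb R^3$ are the partial gradients, and $\frac{\delta\mathcal F}{\delta\boldsymbol E_h}\in V_h^2$, $\frac{\delta\mathcal F}{\delta\boldsymbol B_h}\in V_h^1$ are the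 $L^2(\Omega)$-Riesz representants of the partial derivatives. **Poisson bracket / system.** In coordinates $u$ on $\mathcal U$, a bracket $\{\mathcal F,\mathcal G\}=(\nabla\mathcal F)^\top\mathbb J(u)\nabla\mathcal G$ is a Poisson bracket if $\mathbb J(u)$ is skew-symmetric and satisfies the matrix Jacobi identity $\sum_l\big(\frac{\partial \mathbb J_{ij}}{\partial u_l}\mathbb J_{lk}+\frac{\partial \mathbb J_{jk}}{\partial u_l}\mathbb J_{li}+\frac{\partial \mathbb J_{ki}}{\partial u_l}\mathbb J_{lj}\big)=0$ for all $i,j,k$; the corresponding Poisson system with Hamiltonian $\mathcal H$ is $\dot u=\mathbb J(u)\nabla\mathcal H(u)$.
   Formalization: Added assumption for ℓ=1,2: X ↦ Π^ℓ(e S_X) is differentiable and the X-derivative passes inside Π^ℓ for combinations of first derivatives of S lying in V^ℓ; without it, discontinuous linear projections Π^ℓ can violate the Jacobi identity. *)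

theory Defs
  imports "HOL-Analysis.Analysis"
begin

primrec iter_deriv ::
  "'a list \<Rightarrow> ('a::real_normed_vector \<Rightarrow> 'b::real_normed_vector) \<Rightarrow> 'a \<Rightarrow> 'b" where
  "iter_deriv [] f = f"
| "iter_deriv (v # vs) f = iter_deriv vs (\<lambda>x. frechet_derivative f (at x) v)"

text \<open>On finite-dimensional spaces this is \<open>C\<^sup>\<infinity>\<close>.\<close>

definition smooth_fun :: "('a::real_normed_vector \<Rightarrow> 'b::real_normed_vector) \<Rightarrow> bool" where
  "smooth_fun f \<longleftrightarrow> (\<forall>vs x. iter_deriv vs f differentiable (at x))"

definition support_closure :: "(real^3 \<Rightarrow> real) \<Rightarrow> (real^3) set" where
  "support_closure \<phi> = closure {x. \<phi> x \<noteq> 0}"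

definition test_funs :: "(real^3) set \<Rightarrow> (real^3 \<Rightarrow> real) set" where
  "test_funs \<Omega> = {\<phi>. smooth_fun \<phi> \<and> compact (support_closure \<phi>) \<and> support_closure \<phi> \<subseteq> \<Omega>}"

text \<open>
  The spaces \<open>V\<^sup>\<ell>\<close> may consist of functions or of distributions; both are covered by working
  with (scalar or vector-valued) distributions on \<open>\<real>\<^sup>3\<close>, a locally integrable function \<open>f\<close> being
  the distribution \<open>\<phi> \<mapsto> \<integral> \<phi> f\<close>. Distributions are set to 0 outside the test functions, so that
  equality in HOL is equality of distributions.
\<close>

type_synonym 'b distr = "(real^3 \<Rightarrow> real) \<Rightarrow> 'b"

definition distribution :: "('b::real_normed_vector) distr \<Rightarrow> bool" where
  "distribution T \<longleftrightarrow>
     (\<forall>\<phi>. \<phi> \<notin> test_funs UNIV \<longrightarrow> T \<phi> = 0) \<and>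
     (\<forall>\<phi>\<in>test_funs UNIV. \<forall>\<psi>\<in>test_funs UNIV. \<forall>a b.
        T (\<lambda>x. a * \<phi> x + b * \<psi> x) = a *\<^sub>R T \<phi> + b *\<^sub>R T \<psi>) \<and>
     (\<forall>K. compact K \<longrightarrow> (\<exists>C k. \<forall>\<phi>\<in>test_funs UNIV. \<forall>M. support_closure \<phi> \<subseteq> K \<longrightarrow>
        (\<forall>vs x. set vs \<subseteq> Basis \<and> length vs \<le> k \<longrightarrow> \<bar>iter_deriv vs \<phi> x\<bar> \<le> M) \<longrightarrow>
        norm (T \<phi>) \<le> C * M))"

definition dpartial :: "3 \<Rightarrow> ('b::real_vector) distr \<Rightarrow> 'b distr" where
  "dpartial i T = (\<lambda>\<phi>. if \<phi> \<in> test_funs UNIV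
     then - T (\<lambda>x. frechet_derivative \<phi> (at x) (axis i 1)) else 0)"

definition dgrad :: "real distr \<Rightarrow> (real^3) distr" where
  "dgrad T = (\<lambda>\<phi>. \<chi> i. dpartial i T \<phi>)"

definition dcurl :: "(real^3) distr \<Rightarrow> (real^3) distr" where
  "dcurl T = (\<lambda>\<phi>. vector
     [dpartial 2 T \<phi> $ 3 - dpartial 3 T \<phi> $ 2,
      dpartial 3 T \<phi> $ 1 - dpartial 1 T \<phi> $ 3,
      dpartial 1 T \<phi> $ 2 - dpartial 2 T \<phi> $ 1])"

definition ddiv :: "(real^3) distr \<Rightarrow> real distr" where
  "ddiv T = (\<lambda>\<phi>. \<Sum>i\<in>UNIV. dpartial i T \<phi> $ i)"

text \<open>The translate \<open>T(\<cdot> - y)\<close>.\<close>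

definition translate :: "real^3 \<Rightarrow> 'b distr \<Rightarrow> 'b distr" where
  "translate y T = (\<lambda>\<phi>. T (\<lambda>x. \<phi> (x + y)))"

text \<open>The vector field \<open>e S\<close>, for a constant vector \<open>e\<close> and a scalar \<open>S\<close>.\<close>

definition vec_times :: "real^3 \<Rightarrow> real distr \<Rightarrow> (real^3) distr" where
  "vec_times e S = (\<lambda>\<phi>. S \<phi> *\<^sub>R e)"

definition linear_space :: "('b::real_vector) distr set \<Rightarrow> bool" where
  "linear_space W \<longleftrightarrow> (\<lambda>\<phi>. 0) \<in> W \<and>
     (\<forall>T\<in>W. \<forall>U\<in>W. \<forall>a b. (\<lambda>\<phi>. a *\<^sub>R T \<phi> + b *\<^sub>R U \<phi>) \<in> W)"

definition infinite_dim :: "('b::real_vector) distr set \<Rightarrow> bool" where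
  "infinite_dim W \<longleftrightarrow>
     \<not> (\<exists>A. finite A \<and> A \<subseteq> W \<and> (\<forall>T\<in>W. \<exists>c. T = (\<lambda>\<phi>. \<Sum>U\<in>A. c U *\<^sub>R U \<phi>)))"

definition distr_space :: "('b::real_normed_vector) distr set \<Rightarrow> bool" where
  "distr_space W \<longleftrightarrow> (\<forall>T\<in>W. distribution T) \<and> linear_space W \<and> infinite_dim W \<and>
     (\<forall>T\<in>W. \<forall>x. translate x T \<in> W)"

definition L2_inner ::
  "(real^3) set \<Rightarrow> (real^3 \<Rightarrow> 'b::euclidean_space) \<Rightarrow> (real^3 \<Rightarrow> 'b) \<Rightarrow> real" where
  "L2_inner \<Omega> f g = (LINT x|lebesgue_on \<Omega>. f x \<bullet> g x)"

text \<open>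
  A finite-dimensional space of square-integrable functions on \<open>\<Omega>\<close> (modulo equality almost
  everywhere), with its \<open>L\<^sup>2\<close> inner product, is given by an inner product type \<open>'v\<close> of finite
  dimension (possibly zero) and a map \<open>\<iota>\<close> sending each element to the function it stands for.
  The inner product of \<open>'v\<close> is the \<open>L\<^sup>2\<close> one, so gradients in \<open>'v\<close> are \<open>L\<^sup>2\<close>-Riesz representants.
\<close>

definition discrete_space ::
  "(real^3) set \<Rightarrow> ('v::real_inner \<Rightarrow> real^3 \<Rightarrow> 'b::euclidean_space) \<Rightarrow> bool" where
  "discrete_space \<Omega> \<iota> \<longleftrightarrow>
     (\<exists>A::'v set. finite A \<and> span A = UNIV) \<and>
     (\<forall>x\<in>\<Omega>. linear (\<lambda>u. \<iota> u x)) \<and>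
     (\<forall>u. \<iota> u \<in> borel_measurable (lebesgue_on \<Omega>) \<and>
          integrable (lebesgue_on \<Omega>) (\<lambda>x. (norm (\<iota> u x))\<^sup>2)) \<and>
     (\<forall>u v. u \<bullet> v = L2_inner \<Omega> (\<iota> u) (\<iota> v))"

definition regular_distr ::
  "(real^3) set \<Rightarrow> (real^3 \<Rightarrow> 'b::euclidean_space) \<Rightarrow> 'b distr" where
  "regular_distr \<Omega> f = (\<lambda>\<phi>. LINT x|lebesgue_on \<Omega>. \<phi> x *\<^sub>R f x)"

definition agree_on :: "(real^3) set \<Rightarrow> 'b distr \<Rightarrow> 'b distr \<Rightarrow> bool" where
  "agree_on \<Omega> T U \<longleftrightarrow> (\<forall>\<phi>\<in>test_funs \<Omega>. T \<phi> = U \<phi>)"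

text \<open>
  The functions in the discrete spaces (for instance finite elements) are in general only weakly
  differentiable. The maps \<open>gr\<close>, \<open>cu\<close>, \<open>di\<close> are the weak gradient, curl and divergence on \<open>\<Omega>\<close>
  restricted to the discrete spaces; that they take values in the next space expresses
  \<open>grad V\<^sub>h\<^sup>0 \<subseteq> V\<^sub>h\<^sup>1\<close>, \<open>curl V\<^sub>h\<^sup>1 \<subseteq> V\<^sub>h\<^sup>2\<close> and \<open>div V\<^sub>h\<^sup>2 \<subseteq> V\<^sub>h\<^sup>3\<close>.
\<close>

definition discrete_de_rham ::
  "(real^3) set \<Rightarrow>
   ('v0::real_inner \<Rightarrow> real^3 \<Rightarrow> real) \<Rightarrow> ('v1::real_inner \<Rightarrow> real^3 \<Rightarrow> real^3) \<Rightarrow>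
   ('v2::real_inner \<Rightarrow> real^3 \<Rightarrow> real^3) \<Rightarrow> ('v3::real_inner \<Rightarrow> real^3 \<Rightarrow> real) \<Rightarrow>
   ('v0 \<Rightarrow> 'v1) \<Rightarrow> ('v1 \<Rightarrow> 'v2) \<Rightarrow> ('v2 \<Rightarrow> 'v3) \<Rightarrow> bool" where
  "discrete_de_rham \<Omega> \<iota>0 \<iota>1 \<iota>2 \<iota>3 gr cu di \<longleftrightarrow>
     open \<Omega> \<and>
     discrete_space \<Omega> \<iota>0 \<and> discrete_space \<Omega> \<iota>1 \<and> discrete_space \<Omega> \<iota>2 \<and> discrete_space \<Omega> \<iota>3 \<and>
     linear gr \<and> linear cu \<and> linear di \<and>
     (\<forall>u. agree_on \<Omega> (dgrad (regular_distr \<Omega> (\<iota>0 u))) (regular_distr \<Omega> (\<iota>1 (gr u)))) \<and>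
     (\<forall>u. agree_on \<Omega> (dcurl (regular_distr \<Omega> (\<iota>1 u))) (regular_distr \<Omega> (\<iota>2 (cu u)))) \<and>
     (\<forall>u. agree_on \<Omega> (ddiv (regular_distr \<Omega> (\<iota>2 u))) (regular_distr \<Omega> (\<iota>3 (di u))))"

definition curl_weak ::
  "(real^3) set \<Rightarrow> ('v1 \<Rightarrow> real^3 \<Rightarrow> real^3) \<Rightarrow> ('v2 \<Rightarrow> real^3 \<Rightarrow> real^3) \<Rightarrow>
   ('v1 \<Rightarrow> 'v2) \<Rightarrow> 'v2 \<Rightarrow> 'v1" where
  "curl_weak \<Omega> \<iota>1 \<iota>2 cu F =
     (THE G. \<forall>C. L2_inner \<Omega> (\<iota>1 G) (\<iota>1 C) = L2_inner \<Omega> (\<iota>2 F) (\<iota>2 (cu C)))"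

definition div_weak ::
  "(real^3) set \<Rightarrow> ('v0 \<Rightarrow> real^3 \<Rightarrow> real) \<Rightarrow> ('v1 \<Rightarrow> real^3 \<Rightarrow> real^3) \<Rightarrow>
   ('v0 \<Rightarrow> 'v1) \<Rightarrow> 'v1 \<Rightarrow> 'v0" where
  "div_weak \<Omega> \<iota>0 \<iota>1 gr C =
     (THE d. \<forall>\<psi>. L2_inner \<Omega> (\<iota>0 d) (\<iota>0 \<psi>) = - L2_inner \<Omega> (\<iota>1 C) (\<iota>1 (gr \<psi>)))"

text \<open>
  Elements of \<open>V\<^sup>\<ell>\<close> live on \<open>\<real>\<^sup>3\<close> and discrete functions on \<open>\<Omega>\<close>. The last clause says that each
  discrete function, seen as an element of \<open>V\<^sup>\<ell>\<close> through some extension to \<open>\<real>\<^sup>3\<close> (by zero,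
  periodic, ...), is reproduced by the projection.
\<close>

definition linear_projection ::
  "(real^3) set \<Rightarrow> ('v::real_inner \<Rightarrow> real^3 \<Rightarrow> 'b::euclidean_space) \<Rightarrow>
   'b distr set \<Rightarrow> ('b distr \<Rightarrow> 'v) \<Rightarrow> bool" where
  "linear_projection \<Omega> \<iota> W P \<longleftrightarrow>
     (\<forall>T\<in>W. \<forall>U\<in>W. \<forall>a b. P (\<lambda>\<phi>. a *\<^sub>R T \<phi> + b *\<^sub>R U \<phi>) = a *\<^sub>R P T + b *\<^sub>R P U) \<and>
     (\<forall>u. \<exists>T\<in>W. agree_on \<Omega> T (regular_distr \<Omega> (\<iota> u)) \<and> P T = u)"

definition commuting_projections ::
  "(real^3) set \<Rightarrow>
   ('v0::real_inner \<Rightarrow> real^3 \<Rightarrow> real) \<Rightarrow> ('v1::real_inner \<Rightarrow> real^3 \<Rightarrow> real^3) \<Rightarrow>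
   ('v2::real_inner \<Rightarrow> real^3 \<Rightarrow> real^3) \<Rightarrow> ('v3::real_inner \<Rightarrow> real^3 \<Rightarrow> real) \<Rightarrow>
   ('v0 \<Rightarrow> 'v1) \<Rightarrow> ('v1 \<Rightarrow> 'v2) \<Rightarrow> ('v2 \<Rightarrow> 'v3) \<Rightarrow>
   real distr set \<Rightarrow> (real^3) distr set \<Rightarrow> (real^3) distr set \<Rightarrow> real distr set \<Rightarrow>
   (real distr \<Rightarrow> 'v0) \<Rightarrow> ((real^3) distr \<Rightarrow> 'v1) \<Rightarrow> ((real^3) distr \<Rightarrow> 'v2) \<Rightarrow>
   (real distr \<Rightarrow> 'v3) \<Rightarrow> bool" where
  "commuting_projections \<Omega> \<iota>0 \<iota>1 \<iota>2 \<iota>3 gr cu di W0 W1 W2 W3 P0 P1 P2 P3 \<longleftrightarrow>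
     distr_space W0 \<and> distr_space W1 \<and> distr_space W2 \<and> distr_space W3 \<and>
     dgrad ` W0 \<subseteq> W1 \<and> dcurl ` W1 \<subseteq> W2 \<and> ddiv ` W2 \<subseteq> W3 \<and>
     linear_projection \<Omega> \<iota>0 W0 P0 \<and> linear_projection \<Omega> \<iota>1 W1 P1 \<and>
     linear_projection \<Omega> \<iota>2 W2 P2 \<and> linear_projection \<Omega> \<iota>3 W3 P3 \<and>
     (\<forall>G\<in>W0. P1 (dgrad G) = gr (P0 G)) \<and>
     (\<forall>G\<in>W1. P2 (dcurl G) = cu (P1 G)) \<and>
     (\<forall>G\<in>W2. P3 (ddiv G) = di (P2 G))"

definition admissible_shape ::
  "real distr set \<Rightarrow> (real^3) distr set \<Rightarrow> (real^3) distr set \<Rightarrow> real distr set \<Rightarrow>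
   real distr \<Rightarrow> bool" where
  "admissible_shape W0 W1 W2 W3 S \<longleftrightarrow>
     S \<in> W0 \<and> S \<in> W3 \<and> (\<forall>e. vec_times e S \<in> W1 \<and> vec_times e S \<in> W2)"

text \<open>
  The structure matrix of the bracket has entries depending on the particle positions through
  \<open>\<Pi>(e S\<^sub>X)\<close>, so a Jacobi identity only makes sense if these are differentiable in \<open>X\<close>; and, as
  usual for (continuous) projections, the derivative in \<open>X\<close> is taken inside \<open>\<Pi>\<close>:
  \<open>\<Sum>\<^sub>\<alpha> \<partial>\<^sub>\<alpha> \<Pi>(L(e\<^sub>\<alpha>) S\<^sub>X) = - \<Pi>(L(grad S\<^sub>X)) = - \<Pi>(\<Sum>\<^sub>\<alpha> L(e\<^sub>\<alpha>) (\<partial>\<^sub>\<alpha> S)(\<cdot> - X))\<close>.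
  This is required only for those combinations \<open>L(grad S)\<close> of the derivatives of \<open>S\<close> that lie in
  the domain of \<open>\<Pi>\<close>. It does not follow from the algebraic properties of \<open>\<Pi>\<close>, which may be
  discontinuous.
\<close>

definition differentiable_in_position ::
  "(real^3) distr set \<Rightarrow> ((real^3) distr \<Rightarrow> 'v::real_inner) \<Rightarrow> real distr \<Rightarrow> bool" where
  "differentiable_in_position W P S \<longleftrightarrow>
     (\<forall>e x. (\<lambda>y. P (vec_times e (translate y S))) differentiable (at x)) \<and>
     (\<forall>L x. linear L \<longrightarrow> (\<lambda>\<phi>. L (dgrad S \<phi>)) \<in> W \<longrightarrow>
        (\<Sum>\<alpha>\<in>UNIV. frechet_derivative (\<lambda>y. P (vec_times (L (axis \<alpha> 1)) (translate y S)))
                     (at x) (axis \<alpha> 1))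
        = - P (\<lambda>\<phi>. L (dgrad (translate x S) \<phi>)))"

type_synonym ('n, 'v1, 'v2) state = "((real^3)^'n) \<times> ((real^3)^'n) \<times> 'v2 \<times> 'v1"

definition gradient :: "('a::real_inner \<Rightarrow> real) \<Rightarrow> 'a \<Rightarrow> 'a" where
  "gradient f x = (THE D. GDERIV f x :> D)"

fun delta_X :: "(('n::finite, 'v1, 'v2) state \<Rightarrow> real) \<Rightarrow> 'n \<Rightarrow> ('n, 'v1, 'v2) state \<Rightarrow> real^3" where
  "delta_X F p (X, V, E, B) =
     gradient (\<lambda>x. F ((\<chi> i. if i = p then x else X $ i), V, E, B)) (X $ p)"

fun delta_V :: "(('n::finite, 'v1, 'v2) state \<Rightarrow> real) \<Rightarrow> 'n \<Rightarrow> ('n, 'v1, 'v2) state \<Rightarrow> real^3" where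
  "delta_V F p (X, V, E, B) =
     gradient (\<lambda>v. F (X, (\<chi> i. if i = p then v else V $ i), E, B)) (V $ p)"

fun delta_E ::
  "(('n::finite, 'v1, 'v2::real_inner) state \<Rightarrow> real) \<Rightarrow> ('n, 'v1, 'v2) state \<Rightarrow> 'v2" where
  "delta_E F (X, V, E, B) = gradient (\<lambda>e. F (X, V, e, B)) E"

fun delta_B ::
  "(('n::finite, 'v1::real_inner, 'v2) state \<Rightarrow> real) \<Rightarrow> ('n, 'v1, 'v2) state \<Rightarrow> 'v1" where
  "delta_B F (X, V, E, B) = gradient (\<lambda>b. F (X, V, E, b)) B"

text \<open>With \<open>\<iota>2\<close>, \<open>P2\<close> this is \<open>E\<^sup>S(x)\<close>, with \<open>\<iota>1\<close>, \<open>P1\<close> it is \<open>B\<^sup>S(x)\<close>.\<close>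

definition coupling_field ::
  "(real^3) set \<Rightarrow> ('v \<Rightarrow> real^3 \<Rightarrow> real^3) \<Rightarrow> ((real^3) distr \<Rightarrow> 'v) \<Rightarrow> real distr \<Rightarrow>
   'v \<Rightarrow> real^3 \<Rightarrow> real^3" where
  "coupling_field \<Omega> \<iota> P S F x =
     (\<Sum>\<alpha>\<in>UNIV. L2_inner \<Omega> (\<iota> F) (\<iota> (P (vec_times (axis \<alpha> 1) (translate x S)))) *\<^sub>R axis \<alpha> 1)"

fun vm_bracket ::
  "(real^3) set \<Rightarrow> ('v1::real_inner \<Rightarrow> real^3 \<Rightarrow> real^3) \<Rightarrow> ('v2::real_inner \<Rightarrow> real^3 \<Rightarrow> real^3) \<Rightarrow>
   ('v1 \<Rightarrow> 'v2) \<Rightarrow> ((real^3) distr \<Rightarrow> 'v1) \<Rightarrow> ((real^3) distr \<Rightarrow> 'v2) \<Rightarrow> real distr \<Rightarrow>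
   ('n::finite \<Rightarrow> real) \<Rightarrow> ('n \<Rightarrow> real) \<Rightarrow>
   (('n, 'v1, 'v2) state \<Rightarrow> real) \<Rightarrow> (('n, 'v1, 'v2) state \<Rightarrow> real) \<Rightarrow>
   ('n, 'v1, 'v2) state \<Rightarrow> real" where
  "vm_bracket \<Omega> \<iota>1 \<iota>2 cu P1 P2 S m q F G (X, V, E, B) =
     (let U = (X, V, E, B) in
      (\<Sum>p\<in>UNIV.
         1 / m p * (delta_X F p U \<bullet> delta_V G p U - delta_V F p U \<bullet> delta_X G p U)
       + q p / (m p)\<^sup>2 *
           (coupling_field \<Omega> \<iota>1 P1 S B (X $ p) \<bullet> cross3 (delta_V F p U) (delta_V G p U))
       + q p / m p *
           (LINT x|lebesgue_on \<Omega>.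
              \<iota>2 (P2 (vec_times (delta_V F p U) (translate (X $ p) S))) x \<bullet> \<iota>2 (delta_E G U) x
            - \<iota>2 (delta_E F U) x \<bullet> \<iota>2 (P2 (vec_times (delta_V G p U) (translate (X $ p) S))) x))
      + (LINT x|lebesgue_on \<Omega>.
           \<iota>2 (delta_E F U) x \<bullet> \<iota>2 (cu (delta_B G U)) x
         - \<iota>2 (cu (delta_B F U)) x \<bullet> \<iota>2 (delta_E G U) x))"

fun hamiltonian ::
  "(real^3) set \<Rightarrow> ('v1 \<Rightarrow> real^3 \<Rightarrow> real^3) \<Rightarrow> ('v2 \<Rightarrow> real^3 \<Rightarrow> real^3) \<Rightarrow>
   ('n::finite \<Rightarrow> real) \<Rightarrow> ('n, 'v1, 'v2) state \<Rightarrow> real" where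
  "hamiltonian \<Omega> \<iota>1 \<iota>2 m (X, V, E, B) =
     (\<Sum>p\<in>UNIV. m p / 2 * (norm (V $ p))\<^sup>2)
     + 1 / 2 * (LINT x|lebesgue_on \<Omega>. (norm (\<iota>2 E x))\<^sup>2)
     + 1 / 2 * (LINT x|lebesgue_on \<Omega>. (norm (\<iota>1 B x))\<^sup>2)"

definition coord_gradient :: "(real^'d::finite \<Rightarrow> real) \<Rightarrow> real^'d \<Rightarrow> real^'d" where
  "coord_gradient f u = (\<chi> i. frechet_derivative f (at u) (axis i 1))"

definition matrix_jacobi_at :: "(real^'d::finite \<Rightarrow> real^'d^'d) \<Rightarrow> real^'d \<Rightarrow> bool" where
  "matrix_jacobi_at J u \<longleftrightarrow> (\<forall>i j k.
     (\<Sum>l\<in>UNIV. coord_gradient (\<lambda>v. J v $ i $ j) u $ l * J u $ l $ k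
              + coord_gradient (\<lambda>v. J v $ j $ k) u $ l * J u $ l $ i
              + coord_gradient (\<lambda>v. J v $ k $ i) u $ l * J u $ l $ j) = 0)"

text \<open>
  \<open>\<Phi>\<close> maps coordinates to states. Since the derivatives in the Jacobi identity are taken in all
  directions of the state space, \<open>J\<close> represents the bracket at all states; only the Jacobi identity
  is restricted to the states in \<open>A\<close>.
\<close>

definition poisson_bracket_for ::
  "(real^'d::finite \<Rightarrow> 'u::real_normed_vector) \<Rightarrow> 'u set \<Rightarrow>
   (('u \<Rightarrow> real) \<Rightarrow> ('u \<Rightarrow> real) \<Rightarrow> 'u \<Rightarrow> real) \<Rightarrow> bool" where
  "poisson_bracket_for \<Phi> A br \<longleftrightarrow> (\<exists>J :: real^'d \<Rightarrow> real^'d^'d.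
     (\<forall>F G u. smooth_fun F \<longrightarrow> smooth_fun G \<longrightarrow>
        br F G (\<Phi> u) = coord_gradient (F \<circ> \<Phi>) u \<bullet> (J u *v coord_gradient (G \<circ> \<Phi>) u)) \<and>
     (\<forall>u. transpose (J u) = - J u) \<and>
     (\<forall>i j u. (\<lambda>v. J v $ i $ j) differentiable (at u)) \<and>
     (\<forall>u. \<Phi> u \<in> A \<longrightarrow> matrix_jacobi_at J u))"

definition semi_discrete_at ::
  "(real^3) set \<Rightarrow> ('v1::real_inner \<Rightarrow> real^3 \<Rightarrow> real^3) \<Rightarrow> ('v2::real_inner \<Rightarrow> real^3 \<Rightarrow> real^3) \<Rightarrow>
   ('v1 \<Rightarrow> 'v2) \<Rightarrow> ((real^3) distr \<Rightarrow> 'v1) \<Rightarrow> ((real^3) distr \<Rightarrow> 'v2) \<Rightarrow> real distr \<Rightarrow>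
   ('n::finite \<Rightarrow> real) \<Rightarrow> ('n \<Rightarrow> real) \<Rightarrow> real set \<Rightarrow>
   (real \<Rightarrow> (real^3)^'n) \<Rightarrow> (real \<Rightarrow> (real^3)^'n) \<Rightarrow> (real \<Rightarrow> 'v2) \<Rightarrow> (real \<Rightarrow> 'v1) \<Rightarrow>
   real \<Rightarrow> bool" where
  "semi_discrete_at \<Omega> \<iota>1 \<iota>2 cu P1 P2 S m q I X V E B t \<longleftrightarrow>
     (\<exists>E'. (E has_vector_derivative E') (at t within I) \<and>
        - E' + cu (B t) =
          (\<Sum>p\<in>UNIV. q p *\<^sub>R P2 (vec_times (V t $ p) (translate (X t $ p) S)))) \<and>
     (\<exists>B'. (B has_vector_derivative B') (at t within I) \<and>
        B' + curl_weak \<Omega> \<iota>1 \<iota>2 cu (E t) = 0) \<and>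
     (\<forall>p. ((\<lambda>s. X s $ p) has_vector_derivative V t $ p) (at t within I)) \<and>
     (\<forall>p. ((\<lambda>s. V s $ p) has_vector_derivative
        (q p / m p) *\<^sub>R (coupling_field \<Omega> \<iota>2 P2 S (E t) (X t $ p)
          + cross3 (V t $ p) (coupling_field \<Omega> \<iota>1 P1 S (B t) (X t $ p)))) (at t within I))"

end

theory Submission
  imports Defs
begin

text \<open>
  The Hamiltonian vector field of the bracket moves \<open>X\<^sub>p\<close> by \<open>\<delta>F/\<delta>V\<^sub>p / m\<^sub>p\<close> and \<open>B\<^sub>h\<close> by
  \<open>- curl\<^sub>w \<delta>F/\<delta>E\<^sub>h\<close>, and the structure matrix depends on \<open>X\<close> and \<open>B\<^sub>h\<close> only. The Jacobi sum
  therefore splits into two kinds of terms, for each particle. Those linear in an electric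
  component cancel by \<open>curl ((a \<times> b) S) = (b \<sqdot> \<nabla>S) a - (a \<sqdot> \<nabla>S) b\<close> and \<open>\<Pi>\<^sup>2 curl = curl \<Pi>\<^sup>1\<close>. The
  others add up to a multiple of \<open>\<integral> B\<^sub>h \<sqdot> \<Pi>\<^sup>1(det(a, b, c) grad S) = det(a, b, c) \<integral> B\<^sub>h \<sqdot> grad \<Pi>\<^sup>0 S\<close>,
  which vanishes by the discrete Gauss law.
\<close>

section \<open>Finite-dimensional inner product spaces\<close>

text \<open>The class \<open>euclidean_space\<close> excludes dimension zero, while a discrete space
  may be trivial. Finite dimension is therefore a predicate on types.\<close>

definition finite_dimensional :: "'v::real_vector itself \<Rightarrow> bool" where
  "finite_dimensional _ \<longleftrightarrow> (\<exists>A::'v set. finite A \<and> span A = UNIV)"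

lemma finite_dimensional_euclidean: "finite_dimensional TYPE('v::euclidean_space)"
  unfolding finite_dimensional_def by (rule exI[of _ Basis]) simp

lemma finite_dimensional_prod:
  assumes "finite_dimensional TYPE('v::real_vector)" "finite_dimensional TYPE('w::real_vector)"
  shows "finite_dimensional TYPE('v::real_vector \<times> 'w::real_vector)"
proof -
  obtain A :: "'v set" and B :: "'w set"
    where A: "finite A" "span A = UNIV" and B: "finite B" "span B = UNIV"
    using assms unfolding finite_dimensional_def by blast
  let ?l = "\<lambda>x::'v. (x, 0::'w)" and ?r = "\<lambda>y::'w. (0::'v, y)"
  have l: "linear ?l" and r: "linear ?r"
    by (auto intro!: linearI)
  have "(x, y) \<in> span (?l ` A \<union> ?r ` B)" for x y
  proof -
    have "?l x \<in> span (?l ` A)" "?r y \<in> span (?r ` B)"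
      using A B by (auto simp: linear_span_image[OF l] linear_span_image[OF r])
    then have "?l x \<in> span (?l ` A \<union> ?r ` B)" "?r y \<in> span (?l ` A \<union> ?r ` B)"
      using span_mono[of "?l ` A" "?l ` A \<union> ?r ` B"] span_mono[of "?r ` B" "?l ` A \<union> ?r ` B"]
      by auto
    from span_add[OF this] show ?thesis by simp
  qed
  then show ?thesis
    unfolding finite_dimensional_def using A B
    by (intro exI[of _ "?l ` A \<union> ?r ` B"]) auto
qed

text \<open>Gram-Schmidt yields an orthogonal spanning set that may contain 0. Division by zero
  gives 0, so such a vector contributes nothing to the sum.\<close>

lemma orthogonal_expansion:
  assumes "finite_dimensional TYPE('v::real_inner)"
  obtains C :: "'v::real_inner set" where "finite C" "\<And>x. x = (\<Sum>c\<in>C. (x \<bullet> c / (c \<bullet> c)) *\<^sub>R c)"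
proof -
  obtain A :: "'v set" where A: "finite A" "span A = UNIV"
    using assms unfolding finite_dimensional_def by blast
  obtain C :: "'v set" where C: "finite C" "span C = UNIV" "pairwise orthogonal C"
    using basis_orthogonal[OF A(1)] A(2) by auto
  have "x = (\<Sum>c\<in>C. (x \<bullet> c / (c \<bullet> c)) *\<^sub>R c)" for x
  proof -
    let ?y = "\<Sum>c\<in>C. (x \<bullet> c / (c \<bullet> c)) *\<^sub>R c"
    \<comment> \<open>The remainder is orthogonal to all of \<open>C\<close>, hence to its span,
      hence to itself.\<close>
    have "(x - ?y) \<bullet> d = 0" if "d \<in> C" for d
    proof -
      have "?y \<bullet> d = (\<Sum>c\<in>C. if c = d then x \<bullet> d else 0)"
        unfolding inner_sum_left
        using C(3) that by (intro sum.cong) (auto simp: pairwise_def orthogonal_def)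
      then show ?thesis
        using that C(1) by (simp add: inner_diff_left)
    qed
    then have "C \<subseteq> {z. (x - ?y) \<bullet> z = 0}"
      by blast
    then have "span C \<subseteq> {z. (x - ?y) \<bullet> z = 0}"
      by (rule span_minimal) (auto simp: subspace_def inner_add_right)
    with C(2) have "x - ?y \<in> {z. (x - ?y) \<bullet> z = 0}"
      by blast
    then show ?thesis by simp
  qed
  with C(1) show thesis by (rule that)
qed

lemma finite_dimensional_linear_expansion:
  assumes "finite C" "\<And>x. x = (\<Sum>c\<in>C. (x \<bullet> c / (c \<bullet> c)) *\<^sub>R c)" "linear f"
  shows "f x = (\<Sum>c\<in>C. (x \<bullet> c / (c \<bullet> c)) *\<^sub>R f c)"
proof -
  have "f x = f (\<Sum>c\<in>C. (x \<bullet> c / (c \<bullet> c)) *\<^sub>R c)"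
    using assms(2)[of x] by (rule arg_cong)
  then show ?thesis
    by (simp add: linear_sum[OF assms(3)] linear_cmul[OF assms(3)])
qed

lemma finite_dimensional_bounded_linear:
  assumes "finite_dimensional TYPE('v::real_inner)"
    and f: "linear (f :: 'v::real_inner \<Rightarrow> 'w::real_normed_vector)"
  shows "bounded_linear f"
proof -
  obtain C :: "'v set" where C: "finite C" "\<And>x. x = (\<Sum>c\<in>C. (x \<bullet> c / (c \<bullet> c)) *\<^sub>R c)"
    using orthogonal_expansion[OF assms(1)] by metis
  have eq: "f = (\<lambda>x. \<Sum>c\<in>C. (x \<bullet> c / (c \<bullet> c)) *\<^sub>R f c)"
    using finite_dimensional_linear_expansion[OF C f] by (rule ext)
  show ?thesis
    by (subst eq, intro bounded_linear_sum)
       (simp only: divide_inverse, intro bounded_linear_scaleR_left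
         bounded_linear_compose[OF bounded_linear_scaleR_left]
         bounded_linear_compose[OF bounded_linear_mult_left] bounded_linear_inner_left)
qed

text \<open>Applying \<open>f\<close> to the orthogonal expansion exhibits the representant
  explicitly, with coefficients \<open>f c / (c \<bullet> c)\<close>.\<close>

lemma riesz_representation:
  assumes "finite_dimensional TYPE('v::real_inner)" and f: "linear (f :: 'v::real_inner \<Rightarrow> real)"
  shows "\<exists>r. \<forall>x. f x = r \<bullet> x"
proof -
  obtain C :: "'v set" where C: "finite C" "\<And>x. x = (\<Sum>c\<in>C. (x \<bullet> c / (c \<bullet> c)) *\<^sub>R c)"
    using orthogonal_expansion[OF assms(1)] by metis
  have "f x = (\<Sum>c\<in>C. (f c / (c \<bullet> c)) *\<^sub>R c) \<bullet> x" for x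
    unfolding finite_dimensional_linear_expansion[OF C f, of x] inner_sum_left
    by (intro sum.cong) (auto simp: inner_commute)
  then show ?thesis by blast
qed

section \<open>Gradients and smooth functionals\<close>

lemma gradient_eqI:
  assumes "GDERIV f x :> D"
  shows "gradient f x = D"
  unfolding gradient_def
proof (rule the_equality, rule assms)
  fix D' assume "GDERIV f x :> D'"
  then have "(\<lambda>h. h \<bullet> D') = (\<lambda>h. h \<bullet> D)"
    using assms has_derivative_unique unfolding gderiv_def by blast
  from fun_cong[OF this, of "D' - D"] have "(D' - D) \<bullet> (D' - D) = 0"
    by (simp add: inner_diff_right)
  then show "D' = D" by simp
qed

lemma gradient_exists:
  assumes "finite_dimensional TYPE('v::real_inner)" "f differentiable (at (x::'v::real_inner))"
  shows "GDERIV f x :> gradient f x"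
proof -
  obtain f' where f': "(f has_derivative f') (at x)"
    using assms(2) unfolding differentiable_def by blast
  from riesz_representation[OF assms(1) has_derivative_linear[OF f']]
  obtain r where "f' = (\<lambda>h. h \<bullet> r)"
    by (auto simp: inner_commute)
  with f' have "GDERIV f x :> r"
    unfolding gderiv_def by simp
  then show ?thesis using gradient_eqI by blast
qed

lemma smooth_fun_differentiable: "smooth_fun f \<Longrightarrow> f differentiable (at x)"
  unfolding smooth_fun_def by (metis iter_deriv.simps(1))

lemma smooth_fun_const: "smooth_fun (\<lambda>x. c)"
proof -
  \<comment> \<open>The derivative of a constant is the constant 0, so the induction has to run over
    all constants.\<close>
  have "iter_deriv vs (\<lambda>x::'a. c) differentiable (at x)" for vs x and c :: 'b
    by (induction vs arbitrary: c) simp_all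
  then show ?thesis unfolding smooth_fun_def by blast
qed

text \<open>The derivative in direction \<open>v\<close> is the constant \<open>f v\<close>, so all
  further derivatives are those of a constant.\<close>

lemma smooth_fun_bounded_linear:
  assumes "bounded_linear f"
  shows "smooth_fun f"
  unfolding smooth_fun_def
proof (intro allI)
  fix vs x
  have D: "frechet_derivative f (at y) = f" for y
    using assms by (metis bounded_linear_imp_has_derivative frechet_derivative_at)
  show "iter_deriv vs f differentiable (at x)"
  proof (cases vs)
    case Nil
    then show ?thesis using assms by (simp add: bounded_linear_imp_differentiable)
  next
    case (Cons v ws)
    then show ?thesis
      using smooth_fun_const[of "f v", unfolded smooth_fun_def, rule_format, of ws x]
      by (simp add: D)
  qed
qed

text \<open>Linear functionals are smooth, and they suffice to recover the velocity of a curve.\<close>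

lemma has_vector_derivative_iff_smooth:
  fixes \<gamma> :: "real \<Rightarrow> 'v::real_inner"
  assumes "finite_dimensional TYPE('v)"
  shows "(\<gamma> has_vector_derivative R) (at t within I) \<longleftrightarrow>
    (\<forall>F. smooth_fun F \<longrightarrow>
      ((\<lambda>s. F (\<gamma> s)) has_real_derivative gradient F (\<gamma> t) \<bullet> R) (at t within I))"
proof (intro iffI allI impI)
  fix F :: "'v \<Rightarrow> real"
  assume \<gamma>: "(\<gamma> has_vector_derivative R) (at t within I)" and F: "smooth_fun F"
  have "(F has_derivative (\<lambda>h. h \<bullet> gradient F (\<gamma> t))) (at (\<gamma> t) within \<gamma> ` I)"
    using gradient_exists[OF assms smooth_fun_differentiable[OF F]] has_derivative_at_withinI
    unfolding gderiv_def by blast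
  then show "((\<lambda>s. F (\<gamma> s)) has_real_derivative gradient F (\<gamma> t) \<bullet> R) (at t within I)"
    using vector_derivative_diff_chain_within[OF \<gamma>]
    by (simp add: o_def has_real_derivative_iff_has_vector_derivative inner_commute)
next
  assume *: "\<forall>F. smooth_fun F \<longrightarrow>
      ((\<lambda>s. F (\<gamma> s)) has_real_derivative gradient F (\<gamma> t) \<bullet> R) (at t within I)"
  obtain C :: "'v set" where C: "finite C" "\<And>x. x = (\<Sum>c\<in>C. (x \<bullet> c / (c \<bullet> c)) *\<^sub>R c)"
    using orthogonal_expansion[OF assms] by metis
  have "((\<lambda>s. \<gamma> s \<bullet> c) has_vector_derivative R \<bullet> c) (at t within I)" for c
  proof -
    have "gradient (\<lambda>x. x \<bullet> c) (\<gamma> t) = c"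
      by (intro gradient_eqI)
        (simp add: gderiv_def bounded_linear_imp_has_derivative bounded_linear_inner_left)
    then show ?thesis
      using *[rule_format, OF smooth_fun_bounded_linear[OF bounded_linear_inner_left], of c]
      by (simp add: has_real_derivative_iff_has_vector_derivative inner_commute)
  qed
  \<comment> \<open>The scalar components along \<open>C\<close> reassemble to the curve by the
    orthogonal expansion.\<close>
  then have "((\<lambda>s. \<Sum>c\<in>C. (\<gamma> s \<bullet> c) *\<^sub>R ((1 / (c \<bullet> c)) *\<^sub>R c))
      has_vector_derivative (\<Sum>c\<in>C. (R \<bullet> c) *\<^sub>R ((1 / (c \<bullet> c)) *\<^sub>R c))) (at t within I)"
    by (intro has_vector_derivative_sum
          bounded_linear.has_vector_derivative[OF bounded_linear_scaleR_left]) auto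
  moreover have "(\<Sum>c\<in>C. (x \<bullet> c) *\<^sub>R ((1 / (c \<bullet> c)) *\<^sub>R c)) = x" for x
    using C(2)[of x] by simp
  ultimately show "(\<gamma> has_vector_derivative R) (at t within I)"
    by simp
qed

lemma has_vector_derivative_Pair_iff:
  "((\<lambda>s. (f s, g s)) has_vector_derivative (f', g')) (at t within I) \<longleftrightarrow>
    (f has_vector_derivative f') (at t within I) \<and> (g has_vector_derivative g') (at t within I)"
proof
  assume *: "((\<lambda>s. (f s, g s)) has_vector_derivative (f', g')) (at t within I)"
  from bounded_linear.has_vector_derivative[OF bounded_linear_fst *]
    bounded_linear.has_vector_derivative[OF bounded_linear_snd *]
  show "(f has_vector_derivative f') (at t within I) \<and> (g has_vector_derivative g') (at t within I)"
    by simp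
next
  assume "(f has_vector_derivative f') (at t within I) \<and> (g has_vector_derivative g') (at t within I)"
  then show "((\<lambda>s. (f s, g s)) has_vector_derivative (f', g')) (at t within I)"
    unfolding has_vector_derivative_def by (simp add: has_derivative_Pair)
qed

lemma has_vector_derivative_vec_iff:
  "((Y :: real \<Rightarrow> 'b::euclidean_space^'n::finite) has_vector_derivative (\<chi> p. Y' p)) (at t within I) \<longleftrightarrow>
    (\<forall>p. ((\<lambda>s. Y s $ p) has_vector_derivative Y' p) (at t within I))"
  unfolding has_vector_derivative_def
  by (subst (1 2) has_derivative_componentwise_within) (auto simp: Basis_vec_def inner_axis)

section \<open>Poisson brackets in coordinates\<close>

text \<open>The basis \<open>\<Phi> (axis l 1)\<close> need not be orthonormal. The vector
  \<open>c l\<close> represents the \<open>l\<close>-th coordinate functional of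
  \<open>inv \<Phi>\<close>, so \<open>c\<close> is the dual basis. Pairing a gradient with
  \<open>\<Phi> (axis l 1)\<close> gives a partial derivative, and the second property rebuilds the
  gradient from these.\<close>

lemma dual_basis:
  fixes \<Phi> :: "real^'d::finite \<Rightarrow> 'u::real_inner"
  assumes fd: "finite_dimensional TYPE('u)" and \<Phi>: "linear \<Phi>" "bij \<Phi>"
  obtains c where "\<And>w. \<Phi> (\<chi> l. c l \<bullet> w) = w"
    and "\<And>D. D = (\<Sum>l\<in>UNIV. (D \<bullet> \<Phi> (axis l 1)) *\<^sub>R c l)"
proof -
  let ?\<Psi> = "inv \<Phi>"
  have "linear ?\<Psi>"
  proof (rule linearI)
    have inv: "?\<Psi> w = u \<longleftrightarrow> w = \<Phi> u" for u w
      using \<Phi>(2) by (metis bij_inv_eq_iff)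
    show "?\<Psi> (x + y) = ?\<Psi> x + ?\<Psi> y" and "?\<Psi> (r *\<^sub>R x) = r *\<^sub>R ?\<Psi> x" for x y r
      unfolding inv linear_add[OF \<Phi>(1)] linear_cmul[OF \<Phi>(1)]
      using \<Phi>(2) by (simp_all add: bij_is_surj surj_f_inv_f)
  qed
  then have lin: "linear (\<lambda>w. ?\<Psi> w $ l)" for l
    by (simp add: linear_iff)
  obtain c where c: "\<And>l w. ?\<Psi> w $ l = c l \<bullet> w"
    using riesz_representation[OF fd lin] by metis
  have \<Phi>c: "\<Phi> (\<chi> l. c l \<bullet> w) = w" for w
  proof -
    have "(\<chi> l. c l \<bullet> w) = ?\<Psi> w"
      by (simp add: vec_eq_iff c)
    then show ?thesis using \<Phi>(2) by (simp add: bij_is_surj surj_f_inv_f)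
  qed
  \<comment> \<open>Both sides are paired with every \<open>w\<close>, expanded in the basis
    \<open>\<Phi> (axis l 1)\<close>. Choosing \<open>w\<close> as their difference shows that it
    vanishes.\<close>
  moreover have "D = (\<Sum>l\<in>UNIV. (D \<bullet> \<Phi> (axis l 1)) *\<^sub>R c l)" (is "D = ?s") for D
  proof -
    have "D \<bullet> w = ?s \<bullet> w" for w
    proof -
      have "D \<bullet> w = D \<bullet> \<Phi> (\<Sum>l\<in>UNIV. (c l \<bullet> w) *\<^sub>R axis l 1)"
        using \<Phi>c[of w] basis_expansion[of "\<chi> l. c l \<bullet> w"] by (simp add: scalar_mult_eq_scaleR)
      also have "\<dots> = ?s \<bullet> w"
        by (simp add: linear_sum[OF \<Phi>(1)] linear_cmul[OF \<Phi>(1)] inner_sum_left inner_sum_right mult.commute)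
      finally show ?thesis .
    qed
    from this[of "D - ?s"] have "(D - ?s) \<bullet> (D - ?s) = 0"
      by (simp add: inner_diff_left)
    then show ?thesis by simp
  qed
  ultimately show thesis by (rule that)
qed

lemma linear_sum_axis:
  fixes f' :: "real^'d::finite \<Rightarrow> real"
  assumes "linear f'"
  shows "(\<Sum>l\<in>UNIV. f' (axis l 1) * h $ l) = f' h"
proof -
  have "f' h = f' (\<Sum>l\<in>UNIV. h $ l *\<^sub>R axis l 1)"
    using basis_expansion[of h] by (simp add: scalar_mult_eq_scaleR)
  then show ?thesis
    by (simp add: linear_sum[OF assms] linear_cmul[OF assms] mult.commute)
qed

text \<open>\<open>J\<close> is the form evaluated on the dual basis, that is, on the gradients of
  the coordinate functions. Contracting the partial derivatives of an entry of \<open>J\<close> with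
  column \<open>k\<close> gives the derivative of this entry along \<open>\<xi> U (c k)\<close>. The
  matrix Jacobi identity is thus the hypothesis \<open>jacobi\<close> on dual basis vectors.\<close>

lemma poisson_bracket_for_formI:
  fixes \<Phi> :: "real^'d::finite \<Rightarrow> 'u::real_inner"
  assumes fd: "finite_dimensional TYPE('u)" and \<Phi>: "linear \<Phi>" "bij \<Phi>"
    and br: "\<And>F G U. smooth_fun F \<Longrightarrow> smooth_fun G \<Longrightarrow>
      br F G U = \<omega> U (gradient F U) (gradient G U)"
    and skew: "\<And>U a b. \<omega> U a b = - \<omega> U b a"
    and field: "\<And>U a b. \<omega> U a b = a \<bullet> \<xi> U b"
    and deriv: "\<And>U a b. ((\<lambda>U. \<omega> U a b) has_derivative (\<lambda>w. \<omega>' U w a b)) (at U)"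
    and jacobi: "\<And>U a b c. U \<in> A \<Longrightarrow>
      \<omega>' U (\<xi> U c) a b + \<omega>' U (\<xi> U a) b c + \<omega>' U (\<xi> U b) c a = 0"
  shows "poisson_bracket_for \<Phi> A br"
proof -
  obtain c where \<Phi>c: "\<And>w. \<Phi> (\<chi> l. c l \<bullet> w) = w"
    and expand: "\<And>D. D = (\<Sum>l\<in>UNIV. (D \<bullet> \<Phi> (axis l 1)) *\<^sub>R c l)"
    using dual_basis[OF fd \<Phi>] by metis
  define J where "J u = (\<chi> i j. \<omega> (\<Phi> u) (c i) (c j))" for u
  have \<Phi>': "bounded_linear \<Phi>"
    using \<Phi>(1) by (simp add: linear_conv_bounded_linear)
  have \<Phi>d: "(\<Phi> has_derivative \<Phi>) (at u)" for u
    using \<Phi>' by (rule bounded_linear_imp_has_derivative)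
  have lin1: "linear (\<lambda>a. \<omega> U a b)" for U b
    unfolding field by (simp add: linear_iff inner_add_left)
  \<comment> \<open>Linearity in the first slot comes from the inner product with the field;
    skewness carries it over to the second.\<close>
  have lin2: "linear (\<lambda>b. \<omega> U a b)" for U a
    using linear_compose_neg[OF lin1[of U a]] skew[of U a] by presburger
  have comb1: "\<omega> U (\<Sum>i\<in>UNIV. f i *\<^sub>R c i) b = (\<Sum>i\<in>UNIV. f i * \<omega> U (c i) b)" for f U b
    by (simp add: linear_sum[OF lin1] linear_cmul[OF lin1])
  have comb2: "\<omega> U a (\<Sum>i\<in>UNIV. f i *\<^sub>R c i) = (\<Sum>i\<in>UNIV. \<omega> U a (c i) * f i)" for f U a
    by (simp add: linear_sum[OF lin2] linear_cmul[OF lin2] mult.commute)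
  have Jd: "((\<lambda>v. J v $ i $ j) has_derivative (\<lambda>h. \<omega>' (\<Phi> u) (\<Phi> h) (c i) (c j))) (at u)" for i j u
    unfolding J_def by (simp, rule has_derivative_compose[OF \<Phi>d deriv])
  have grad: "coord_gradient (F \<circ> \<Phi>) u = (\<chi> i. gradient F (\<Phi> u) \<bullet> \<Phi> (axis i 1))"
    if "smooth_fun F" for F u
  proof -
    have "(F has_derivative (\<lambda>h. h \<bullet> gradient F (\<Phi> u))) (at (\<Phi> u))"
      using gradient_exists[OF fd smooth_fun_differentiable[OF that]] unfolding gderiv_def .
    from has_derivative_compose[OF \<Phi>d this]
    have "frechet_derivative (F \<circ> \<Phi>) (at u) = (\<lambda>h. \<Phi> h \<bullet> gradient F (\<Phi> u))"
      unfolding o_def by (rule frechet_derivative_at[symmetric])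
    then show ?thesis
      by (simp add: coord_gradient_def inner_commute)
  qed
  have "br F G (\<Phi> u) = coord_gradient (F \<circ> \<Phi>) u \<bullet> (J u *v coord_gradient (G \<circ> \<Phi>) u)"
    if F: "smooth_fun F" and G: "smooth_fun G" for F G u
  proof -
    let ?f = "\<lambda>i. gradient F (\<Phi> u) \<bullet> \<Phi> (axis i 1)" and ?g = "\<lambda>i. gradient G (\<Phi> u) \<bullet> \<Phi> (axis i 1)"
    have "br F G (\<Phi> u) = \<omega> (\<Phi> u) (\<Sum>i\<in>UNIV. ?f i *\<^sub>R c i) (\<Sum>j\<in>UNIV. ?g j *\<^sub>R c j)"
      unfolding br[OF F G] expand[of "gradient F (\<Phi> u)", symmetric]
        expand[of "gradient G (\<Phi> u)", symmetric] ..
    also have "\<dots> = (\<Sum>i\<in>UNIV. ?f i * \<omega> (\<Phi> u) (c i) (\<Sum>j\<in>UNIV. ?g j *\<^sub>R c j))"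
      by (rule comb1)
    also have "\<dots> = (\<Sum>i\<in>UNIV. ?f i * (\<Sum>j\<in>UNIV. \<omega> (\<Phi> u) (c i) (c j) * ?g j))"
      unfolding comb2 ..
    finally show ?thesis
      by (simp add: grad[OF F] grad[OF G] inner_vec_def matrix_vector_mult_def J_def)
  qed
  moreover have "transpose (J u) = - J u" for u
    unfolding J_def transpose_def vec_eq_iff by (simp, intro allI skew)
  moreover have "(\<lambda>v. J v $ i $ j) differentiable (at u)" for i j u
    using Jd unfolding differentiable_def by blast
  moreover have "matrix_jacobi_at J u" if u: "\<Phi> u \<in> A" for u
  proof -
    have "(\<Sum>l\<in>UNIV. coord_gradient (\<lambda>v. J v $ i $ j) u $ l * J u $ l $ k)
        = \<omega>' (\<Phi> u) (\<xi> (\<Phi> u) (c k)) (c i) (c j)" for i j k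
    proof -
      \<comment> \<open>Column \<open>k\<close> of \<open>J u\<close> lists the coordinates of
        \<open>\<xi> (\<Phi> u) (c k)\<close>, which \<open>\<Phi>c\<close> reassembles to the
        vector itself.\<close>
      have "(\<Sum>l\<in>UNIV. coord_gradient (\<lambda>v. J v $ i $ j) u $ l * J u $ l $ k)
        = (\<Sum>l\<in>UNIV. \<omega>' (\<Phi> u) (\<Phi> (axis l 1)) (c i) (c j) * (\<chi> l. c l \<bullet> \<xi> (\<Phi> u) (c k)) $ l)"
        unfolding coord_gradient_def frechet_derivative_at[OF Jd, symmetric]
        by (simp add: J_def field)
      also have "\<dots> = \<omega>' (\<Phi> u) (\<Phi> (\<chi> l. c l \<bullet> \<xi> (\<Phi> u) (c k))) (c i) (c j)"
        by (rule linear_sum_axis[OF has_derivative_linear[OF Jd]])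
      finally show ?thesis by (simp add: \<Phi>c)
    qed
    then show ?thesis
      unfolding matrix_jacobi_at_def using jacobi[OF u] by (simp add: sum.distrib)
  qed
  ultimately show ?thesis
    unfolding poisson_bracket_for_def by blast
qed

section \<open>Discrete spaces and weak operators\<close>

lemma discrete_space_finite_dimensional:
  "discrete_space \<Omega> (\<iota> :: 'v::real_inner \<Rightarrow> real^3 \<Rightarrow> 'b::euclidean_space) \<Longrightarrow>
    finite_dimensional TYPE('v)"
  unfolding discrete_space_def finite_dimensional_def by blast

lemma discrete_space_L2_inner: "discrete_space \<Omega> \<iota> \<Longrightarrow> L2_inner \<Omega> (\<iota> u) (\<iota> v) = u \<bullet> v"
  unfolding discrete_space_def by simp

lemma discrete_space_integral_inner:
  "discrete_space \<Omega> \<iota> \<Longrightarrow> (LINT x|lebesgue_on \<Omega>. \<iota> u x \<bullet> \<iota> v x) = u \<bullet> v"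
  using discrete_space_L2_inner[of \<Omega> \<iota> u v] unfolding L2_inner_def by simp

text \<open>Integrability is what permits splitting the integrals of differences in the bracket. The
  product is dominated by the sum of the two squared norms.\<close>

lemma discrete_space_integrable_inner:
  assumes "discrete_space \<Omega> \<iota>"
  shows "integrable (lebesgue_on \<Omega>) (\<lambda>x. \<iota> u x \<bullet> \<iota> v x)"
proof (rule Bochner_Integration.integrable_bound)
  show "integrable (lebesgue_on \<Omega>) (\<lambda>x. (norm (\<iota> u x))\<^sup>2 + (norm (\<iota> v x))\<^sup>2)"
    using assms unfolding discrete_space_def by (intro Bochner_Integration.integrable_add) auto
  show "(\<lambda>x. \<iota> u x \<bullet> \<iota> v x) \<in> borel_measurable (lebesgue_on \<Omega>)"
    using assms unfolding discrete_space_def by (intro borel_measurable_inner) auto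
  have "\<bar>a \<bullet> b\<bar> \<le> (norm a)\<^sup>2 + (norm b)\<^sup>2" for a b :: 'b
  proof -
    have "\<bar>a \<bullet> b\<bar> \<le> norm a * norm b" by (rule Cauchy_Schwarz_ineq2)
    also have "2 * (norm a * norm b) \<le> (norm a)\<^sup>2 + (norm b)\<^sup>2"
      using sum_squares_bound[of "norm a" "norm b"] by simp
    then have "norm a * norm b \<le> (norm a)\<^sup>2 + (norm b)\<^sup>2"
      using mult_nonneg_nonneg[OF norm_ge_zero norm_ge_zero, of a b] by linarith
    finally show ?thesis .
  qed
  then show "AE x in lebesgue_on \<Omega>. norm (\<iota> u x \<bullet> \<iota> v x)
      \<le> norm ((norm (\<iota> u x))\<^sup>2 + (norm (\<iota> v x))\<^sup>2)"
    by simp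
qed

lemma discrete_space_integral_diff:
  assumes "discrete_space \<Omega> \<iota>"
  shows "(LINT x|lebesgue_on \<Omega>. \<iota> u x \<bullet> \<iota> v x - \<iota> w x \<bullet> \<iota> z x) = u \<bullet> v - w \<bullet> z"
  by (simp add: Bochner_Integration.integral_diff discrete_space_integrable_inner[OF assms]
      discrete_space_integral_inner[OF assms])

text \<open>The weak operators are definite descriptions: Riesz representation gives existence,
  definiteness of the inner product gives uniqueness.\<close>

lemma inner_the_representant:
  assumes "finite_dimensional TYPE('v::real_inner)" and "linear (f :: 'v::real_inner \<Rightarrow> real)"
  shows "(THE r. \<forall>x. r \<bullet> x = f x) \<bullet> x = f x"
proof -
  obtain r where r: "\<forall>x. r \<bullet> x = f x"
    using riesz_representation[OF assms] by metis
  have "(THE r. \<forall>x. r \<bullet> x = f x) = r"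
  proof (rule the_equality, rule r)
    fix s assume "\<forall>x. s \<bullet> x = f x"
    then have "(s - r) \<bullet> (s - r) = 0"
      using r by (simp add: inner_diff_left)
    then show "s = r" by simp
  qed
  with r show ?thesis by simp
qed

lemma curl_weak_inner:
  fixes \<iota>1 :: "'v1::real_inner \<Rightarrow> real^3 \<Rightarrow> real^3" and \<iota>2 :: "'v2::real_inner \<Rightarrow> real^3 \<Rightarrow> real^3"
  assumes "discrete_space \<Omega> \<iota>1" "discrete_space \<Omega> \<iota>2" "linear cu"
  shows "curl_weak \<Omega> \<iota>1 \<iota>2 cu F \<bullet> C = F \<bullet> cu C"
proof -
  have "linear (\<lambda>C. F \<bullet> cu C)"
    using assms(3) by (simp add: linear_iff inner_add_right)
  from inner_the_representant[OF discrete_space_finite_dimensional[OF assms(1)] this]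
  show ?thesis
    unfolding curl_weak_def discrete_space_L2_inner[OF assms(1)]
      discrete_space_L2_inner[OF assms(2)] .
qed

lemma div_weak_inner:
  fixes \<iota>0 :: "'v0::real_inner \<Rightarrow> real^3 \<Rightarrow> real" and \<iota>1 :: "'v1::real_inner \<Rightarrow> real^3 \<Rightarrow> real^3"
  assumes "discrete_space \<Omega> \<iota>0" "discrete_space \<Omega> \<iota>1" "linear gr"
  shows "div_weak \<Omega> \<iota>0 \<iota>1 gr C \<bullet> \<psi> = - (C \<bullet> gr \<psi>)"
proof -
  have "linear (\<lambda>\<psi>. - (C \<bullet> gr \<psi>))"
    using assms(3) by (simp add: linear_iff inner_add_right)
  from inner_the_representant[OF discrete_space_finite_dimensional[OF assms(1)] this]
  show ?thesis
    unfolding div_weak_def discrete_space_L2_inner[OF assms(1)]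
      discrete_space_L2_inner[OF assms(2)] .
qed

section \<open>Smeared shape functions\<close>

text \<open>As \<open>n\<close> is constant, every derivative falls on the scalar
  \<open>T\<close>.\<close>

lemma dcurl_vec_times: "dcurl (vec_times n T) \<phi> = cross3 (dgrad T \<phi>) n"
  unfolding dcurl_def dgrad_def dpartial_def vec_times_def cross3_def
  by (simp add: vec_eq_iff forall_3)

text \<open>Expansion of \<open>e\<close> in the reciprocal basis of \<open>a\<close>,
  \<open>b\<close>, \<open>c\<close>, multiplied by the determinant so that it holds for dependent
  vectors as well. It merges the three magnetic terms of the Jacobi sum into a multiple of a
  gradient.\<close>

lemma cross_triple_det:
  "(e \<bullet> c) *\<^sub>R cross3 a b + (e \<bullet> a) *\<^sub>R cross3 b c + (e \<bullet> b) *\<^sub>R cross3 c a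
    = (a \<bullet> cross3 b c) *\<^sub>R e"
  unfolding cross3_def inner_vec_def sum_3 vec_eq_iff forall_3
  by (simp add: algebra_simps)

text \<open>With \<open>e\<close> a gradient of the shape function, this evaluates the curl of
  \<open>cross3 a b\<close> times the shape.\<close>

lemma cross_cross_right: "cross3 e (cross3 a b) = (e \<bullet> b) *\<^sub>R a - (e \<bullet> a) *\<^sub>R b"
  unfolding cross3_def inner_vec_def sum_3 vec_eq_iff forall_3
  by (simp add: algebra_simps)

lemma inner_cross_cyclic: "b \<bullet> cross3 v w = v \<bullet> cross3 w b"
  unfolding cross3_def inner_vec_def sum_3 by (simp add: algebra_simps)

text \<open>Common to both couplings: instantiated below as \<open>B\<close> with the first
  projection and as \<open>E\<close> with the second.\<close>

locale smeared_shape =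
  fixes \<Omega> :: "(real^3) set" and \<iota> :: "'v::real_inner \<Rightarrow> real^3 \<Rightarrow> real^3"
    and W :: "(real^3) distr set" and P :: "(real^3) distr \<Rightarrow> 'v" and S :: "real distr"
  assumes discrete: "discrete_space \<Omega> \<iota>"
    and domain: "distr_space W"
    and projection: "linear_projection \<Omega> \<iota> W P"
    and shape_in_domain: "vec_times e S \<in> W"
    and differentiable: "differentiable_in_position W P S"
begin

definition smear :: "real^3 \<Rightarrow> real^3 \<Rightarrow> 'v" where
  "smear e x = P (vec_times e (translate x S))"

definition dsmear :: "real^3 \<Rightarrow> real^3 \<Rightarrow> real^3 \<Rightarrow> 'v" where
  "dsmear e x = frechet_derivative (smear e) (at x)"

lemma projection_combination:
  "T \<in> W \<Longrightarrow> U \<in> W \<Longrightarrow> P (\<lambda>\<phi>. a *\<^sub>R T \<phi> + b *\<^sub>R U \<phi>) = a *\<^sub>R P T + b *\<^sub>R P U"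
  using projection unfolding linear_projection_def by blast

lemma projection_scaleR: "T \<in> W \<Longrightarrow> P (\<lambda>\<phi>. a *\<^sub>R T \<phi>) = a *\<^sub>R P T"
  using projection_combination[of T T a 0] by simp

lemma domain_scaleR: "T \<in> W \<Longrightarrow> (\<lambda>\<phi>. a *\<^sub>R T \<phi>) \<in> W"
proof -
  assume "T \<in> W"
  moreover have "\<forall>T\<in>W. \<forall>U\<in>W. \<forall>a b. (\<lambda>\<phi>. a *\<^sub>R T \<phi> + b *\<^sub>R U \<phi>) \<in> W"
    using domain unfolding distr_space_def linear_space_def by blast
  ultimately have "(\<lambda>\<phi>. a *\<^sub>R T \<phi> + 0 *\<^sub>R T \<phi>) \<in> W" by blast
  then show ?thesis by simp
qed

lemma translate_shape_in_domain: "vec_times e (translate x S) \<in> W"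
proof -
  have "translate x (vec_times e S) \<in> W"
    using domain shape_in_domain unfolding distr_space_def by blast
  then show ?thesis
    by (simp add: translate_def vec_times_def)
qed

lemma smear_combination: "smear (a *\<^sub>R d + b *\<^sub>R e) x = a *\<^sub>R smear d x + b *\<^sub>R smear e x"
proof -
  have "vec_times (a *\<^sub>R d + b *\<^sub>R e) (translate x S)
      = (\<lambda>\<phi>. a *\<^sub>R vec_times d (translate x S) \<phi> + b *\<^sub>R vec_times e (translate x S) \<phi>)"
    by (simp add: vec_times_def fun_eq_iff scaleR_add_right mult.commute)
  then show ?thesis
    unfolding smear_def by (simp only: projection_combination translate_shape_in_domain)
qed

lemma linear_smear: "linear (\<lambda>e. smear e x)"
proof (rule linearI)
  show "smear (d + e) x = smear d x + smear e x" for d e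
    using smear_combination[of 1 d 1 e] by simp
  show "smear (r *\<^sub>R e) x = r *\<^sub>R smear e x" for r e
    using smear_combination[of r e 0 0] by simp
qed

text \<open>The projection is linear in \<open>e\<close>, so the sum over the canonical basis
  represents the functional that sends \<open>e\<close> to the pairing of \<open>F\<close> with the
  smeared shape.\<close>

lemma coupling_field_inner: "coupling_field \<Omega> \<iota> P S F x \<bullet> e = F \<bullet> smear e x"
proof -
  have "smear e x = (\<Sum>\<alpha>\<in>UNIV. e $ \<alpha> *\<^sub>R smear (axis \<alpha> 1) x)"
    using basis_expansion[of e] linear_sum[OF linear_smear, of "\<lambda>\<alpha>. e $ \<alpha> *\<^sub>R axis \<alpha> 1" UNIV]
    by (simp add: scalar_mult_eq_scaleR linear_cmul[OF linear_smear])
  then show ?thesis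
    unfolding coupling_field_def
    by (simp add: discrete_space_L2_inner[OF discrete] inner_sum_left inner_sum_right
        inner_axis' smear_def mult.commute)
qed

lemma smear_has_derivative: "(smear e has_derivative dsmear e x) (at x)"
  using differentiable unfolding differentiable_in_position_def smear_def[abs_def] dsmear_def
  by (simp add: frechet_derivative_works smear_def[abs_def])

lemma linear_dsmear: "linear (dsmear e x)"
  using smear_has_derivative by (rule has_derivative_linear)

lemma dsmear_combination:
  "dsmear (a *\<^sub>R d + b *\<^sub>R e) x w = a *\<^sub>R dsmear d x w + b *\<^sub>R dsmear e x w"
proof -
  have "((\<lambda>x. a *\<^sub>R smear d x + b *\<^sub>R smear e x) has_derivative
      (\<lambda>w. a *\<^sub>R dsmear d x w + b *\<^sub>R dsmear e x w)) (at x)"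
    by (intro derivative_intros smear_has_derivative)
  then have "(smear (a *\<^sub>R d + b *\<^sub>R e) has_derivative
      (\<lambda>w. a *\<^sub>R dsmear d x w + b *\<^sub>R dsmear e x w)) (at x)"
    unfolding smear_combination[symmetric] by simp
  then show ?thesis
    using has_derivative_unique[OF smear_has_derivative] by metis
qed

lemma linear_dsmear_direction: "linear (\<lambda>e. dsmear e x w)"
proof (rule linearI)
  show "dsmear (d + e) x w = dsmear d x w + dsmear e x w" for d e
    using dsmear_combination[of 1 d 1 e] by simp
  show "dsmear (r *\<^sub>R e) x w = r *\<^sub>R dsmear e x w" for r e
    using dsmear_combination[of r e 0 0] by simp
qed

text \<open>This is the sum in \<open>differentiable_in_position\<close> for the rank-one map
  sending \<open>e\<close> to \<open>(e \<bullet> b) *\<^sub>R a\<close>. Moving the scalar from the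
  vector slot to the direction slot collapses it to one directional derivative.\<close>

lemma sum_dsmear_axis:
  "(\<Sum>\<alpha>\<in>UNIV. dsmear ((axis \<alpha> 1 \<bullet> b) *\<^sub>R a) x (axis \<alpha> 1)) = dsmear a x b"
proof -
  have "dsmear a x b = dsmear a x (\<Sum>\<alpha>\<in>UNIV. b $ \<alpha> *\<^sub>R axis \<alpha> 1)"
    using basis_expansion[of b] by (simp add: scalar_mult_eq_scaleR)
  then show ?thesis
    by (simp add: linear_sum[OF linear_dsmear] linear_cmul[OF linear_dsmear]
        linear_cmul[OF linear_dsmear_direction] inner_axis')
qed

lemma sum_dsmear:
  assumes "linear L" "(\<lambda>\<phi>. L (dgrad S \<phi>)) \<in> W"
  shows "(\<Sum>\<alpha>\<in>UNIV. dsmear (L (axis \<alpha> 1)) x (axis \<alpha> 1))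
    = - P (\<lambda>\<phi>. L (dgrad (translate x S) \<phi>))"
  using differentiable assms
  unfolding differentiable_in_position_def dsmear_def smear_def[abs_def] by blast

end

section \<open>The Vlasov--Maxwell bracket\<close>

text \<open>Freezing all other variables composes \<open>F\<close> with an affine insertion into one
  slot. By the chain rule the partial gradient is the corresponding component of the full
  one.\<close>

lemma delta_gradient:
  fixes F :: "('n::finite, 'v1::real_inner, 'v2::real_inner) state \<Rightarrow> real"
  assumes "GDERIV F (X, V, E, B) :> (dX, dV, dE, dB)"
  shows "delta_X F p (X, V, E, B) = dX $ p" "delta_V F p (X, V, E, B) = dV $ p"
    "delta_E F (X, V, E, B) = dE" "delta_B F (X, V, E, B) = dB"
proof -
  have F: "(F has_derivative (\<lambda>h. h \<bullet> (dX, dV, dE, dB))) (at (X, V, E, B))"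
    using assms unfolding gderiv_def .
  have upd: "((\<lambda>x. \<chi> i. if i = p then x else Y $ i) has_derivative axis p) (at (Y $ p))"
    for Y :: "(real^3)^'n"
  proof -
    \<comment> \<open>Replacing entry \<open>p\<close> is affine in the new entry, with linear part
      \<open>axis p\<close>.\<close>
    have "(\<lambda>x. \<chi> i. if i = p then x else Y $ i) = (\<lambda>x. Y + axis p (x - Y $ p))"
      by (auto simp: fun_eq_iff vec_eq_iff axis_def)
    moreover have "bounded_linear (axis p :: real^3 \<Rightarrow> (real^3)^'n)"
      by (rule finite_dimensional_bounded_linear[OF finite_dimensional_euclidean])
        (auto simp: linear_iff vec_eq_iff axis_def)
    ultimately show ?thesis
      by (auto intro!: derivative_eq_intros bounded_linear.has_derivative[of "axis p"])
  qed
  have id: "(\<chi> i. if i = p then Y $ p else Y $ i) = Y" for Y :: "(real^3)^'n"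
    by (simp add: vec_eq_iff)
  have "((\<lambda>x. F ((\<chi> i. if i = p then x else X $ i), V, E, B)) has_derivative
      (\<lambda>h. (axis p h, 0, 0, 0) \<bullet> (dX, dV, dE, dB))) (at (X $ p))"
    by (rule has_derivative_compose[of "\<lambda>x. ((\<chi> i. if i = p then x else X $ i), V, E, B)"])
      (auto intro!: has_derivative_Pair upd simp: id F)
  then show "delta_X F p (X, V, E, B) = dX $ p"
    by (auto intro!: gradient_eqI simp: gderiv_def inner_axis')
  have "((\<lambda>x. F (X, (\<chi> i. if i = p then x else V $ i), E, B)) has_derivative
      (\<lambda>h. (0, axis p h, 0, 0) \<bullet> (dX, dV, dE, dB))) (at (V $ p))"
    by (rule has_derivative_compose[of "\<lambda>x. (X, (\<chi> i. if i = p then x else V $ i), E, B)"])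
      (auto intro!: has_derivative_Pair upd simp: id F)
  then show "delta_V F p (X, V, E, B) = dV $ p"
    by (auto intro!: gradient_eqI simp: gderiv_def inner_axis')
  have "((\<lambda>e. F (X, V, e, B)) has_derivative
      (\<lambda>h. (0, 0, h, 0) \<bullet> (dX, dV, dE, dB))) (at E)"
    by (rule has_derivative_compose[of "\<lambda>e. (X, V, e, B)"])
      (auto intro!: has_derivative_Pair simp: F)
  then show "delta_E F (X, V, E, B) = dE"
    by (auto intro!: gradient_eqI simp: gderiv_def)
  have "((\<lambda>b. F (X, V, E, b)) has_derivative
      (\<lambda>h. (0, 0, 0, h) \<bullet> (dX, dV, dE, dB))) (at B)"
    by (rule has_derivative_compose[of "\<lambda>b. (X, V, E, b)"])
      (auto intro!: has_derivative_Pair simp: F)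
  then show "delta_B F (X, V, E, B) = dB"
    by (auto intro!: gradient_eqI simp: gderiv_def)
qed

locale structure_preserving_particles =
  fixes \<Omega> :: "(real^3) set"
    and \<iota>0 :: "'v0::real_inner \<Rightarrow> real^3 \<Rightarrow> real"
    and \<iota>1 :: "'v1::real_inner \<Rightarrow> real^3 \<Rightarrow> real^3"
    and \<iota>2 :: "'v2::real_inner \<Rightarrow> real^3 \<Rightarrow> real^3"
    and \<iota>3 :: "'v3::real_inner \<Rightarrow> real^3 \<Rightarrow> real"
    and gr :: "'v0 \<Rightarrow> 'v1" and cu :: "'v1 \<Rightarrow> 'v2" and di :: "'v2 \<Rightarrow> 'v3"
    and W0 W3 :: "real distr set" and W1 W2 :: "(real^3) distr set"
    and P0 :: "real distr \<Rightarrow> 'v0" and P1 :: "(real^3) distr \<Rightarrow> 'v1"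
    and P2 :: "(real^3) distr \<Rightarrow> 'v2" and P3 :: "real distr \<Rightarrow> 'v3"
    and S :: "real distr"
    and m q :: "'n::finite \<Rightarrow> real"
  assumes de_rham: "discrete_de_rham \<Omega> \<iota>0 \<iota>1 \<iota>2 \<iota>3 gr cu di"
    and commuting: "commuting_projections \<Omega> \<iota>0 \<iota>1 \<iota>2 \<iota>3 gr cu di W0 W1 W2 W3 P0 P1 P2 P3"
    and admissible: "admissible_shape W0 W1 W2 W3 S"
    and differentiable1: "differentiable_in_position W1 P1 S"
    and differentiable2: "differentiable_in_position W2 P2 S"
    and mass_nonzero: "\<And>p. m p \<noteq> 0"
begin

sublocale B: smeared_shape \<Omega> \<iota>1 W1 P1 S
  using de_rham commuting admissible differentiable1
  by unfold_locales
    (auto simp: discrete_de_rham_def commuting_projections_def admissible_shape_def)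

sublocale E: smeared_shape \<Omega> \<iota>2 W2 P2 S
  using de_rham commuting admissible differentiable2
  by unfold_locales
    (auto simp: discrete_de_rham_def commuting_projections_def admissible_shape_def)

section \<open>Consequences of the commuting diagram and the Gauss law\<close>

lemma linear_gr: "linear gr" and linear_cu: "linear cu"
  using de_rham unfolding discrete_de_rham_def by auto

lemma curl_weak_cu: "curl_weak \<Omega> \<iota>1 \<iota>2 cu F \<bullet> C = F \<bullet> cu C"
  by (rule curl_weak_inner[OF B.discrete E.discrete linear_cu])

lemma inner_gr_eq_0:
  assumes "div_weak \<Omega> \<iota>0 \<iota>1 gr C = 0"
  shows "C \<bullet> gr \<psi> = 0"
proof -
  have "discrete_space \<Omega> \<iota>0"
    using de_rham unfolding discrete_de_rham_def by blast
  from div_weak_inner[OF this B.discrete linear_gr, of C \<psi>] show ?thesis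
    using assms by simp
qed

lemma finite_dimensional_state: "finite_dimensional TYPE(('n, 'v1, 'v2) state)"
  by (intro finite_dimensional_prod finite_dimensional_euclidean
      discrete_space_finite_dimensional[OF B.discrete]
      discrete_space_finite_dimensional[OF E.discrete])

text \<open>The discrete curl passes through the projection and hits \<open>cross3 a b\<close> times
  the shape, giving the difference of two directional derivatives of the shape. Differentiating in
  the particle position instead of in space flips the sign.\<close>

lemma cu_smear: "cu (B.smear (cross3 a b) x) = E.dsmear b x a - E.dsmear a x b"
proof -
  let ?L = "\<lambda>e. (e \<bullet> b) *\<^sub>R a - (e \<bullet> a) *\<^sub>R b"
  have L: "dcurl (vec_times (cross3 a b) T) = (\<lambda>\<phi>. ?L (dgrad T \<phi>))" for T
    by (simp add: fun_eq_iff dcurl_vec_times cross_cross_right)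
  have curl: "dcurl G \<in> W2" "P2 (dcurl G) = cu (P1 G)" if "G \<in> W1" for G
    using commuting that unfolding commuting_projections_def by blast+
  have "linear ?L"
    by (simp add: linear_iff inner_add_left algebra_simps)
  \<comment> \<open>The two terms of \<open>?L\<close> are not known to lie in \<open>W2\<close>
    separately; their difference does, being the curl of an element of \<open>W1\<close>. Hence
    \<open>?L\<close> is treated as a whole.\<close>
  moreover have "(\<lambda>\<phi>. ?L (dgrad S \<phi>)) \<in> W2"
    using curl(1)[OF B.shape_in_domain, of "cross3 a b"] unfolding L .
  ultimately have "- P2 (\<lambda>\<phi>. ?L (dgrad (translate x S) \<phi>))
      = (\<Sum>\<alpha>\<in>UNIV. E.dsmear (?L (axis \<alpha> 1)) x (axis \<alpha> 1))"
    by (rule E.sum_dsmear[symmetric])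
  also have "\<dots> = E.dsmear a x b - E.dsmear b x a"
    by (simp add: linear_diff[OF E.linear_dsmear_direction] sum_subtractf E.sum_dsmear_axis)
  finally have "P2 (dcurl (vec_times (cross3 a b) (translate x S))) = E.dsmear b x a - E.dsmear a x b"
    unfolding L by (simp add: algebra_simps)
  then show ?thesis
    using curl(2)[OF B.translate_shape_in_domain] unfolding B.smear_def by simp
qed

text \<open>The three terms add up to a multiple of the projected gradient of the translated shape.
  This is a discrete gradient by the commuting diagram, and \<open>C\<close> is orthogonal to all of
  those.\<close>

lemma gauss_law_dsmear:
  assumes "div_weak \<Omega> \<iota>0 \<iota>1 gr C = 0"
  shows "C \<bullet> B.dsmear (cross3 a b) x c + C \<bullet> B.dsmear (cross3 b c) x a
    + C \<bullet> B.dsmear (cross3 c a) x b = 0"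
proof -
  let ?d = "a \<bullet> cross3 b c"
  have S: "S \<in> W0"
    using admissible unfolding admissible_shape_def by simp
  have "\<forall>T\<in>W0. \<forall>x. translate x T \<in> W0"
    using commuting unfolding commuting_projections_def distr_space_def by simp
  with S have W0: "translate x S \<in> W0" by simp
  have grad: "dgrad G \<in> W1" "P1 (dgrad G) = gr (P0 G)" if "G \<in> W0" for G
    using commuting that unfolding commuting_projections_def by blast+
  \<comment> \<open>The reciprocal-basis expansion is used in the vector slot. Taking
    \<open>e\<close> and \<open>w\<close> both as \<open>axis \<alpha> 1\<close> and summing turns
    each term into one directional derivative.\<close>
  have "B.dsmear (?d *\<^sub>R e) x w = B.dsmear ((e \<bullet> c) *\<^sub>R cross3 a b) x w
      + B.dsmear ((e \<bullet> a) *\<^sub>R cross3 b c) x w + B.dsmear ((e \<bullet> b) *\<^sub>R cross3 c a) x w" for e w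
    unfolding cross_triple_det[of e c a b, symmetric] linear_add[OF B.linear_dsmear_direction] ..
  then have "B.dsmear (cross3 a b) x c + B.dsmear (cross3 b c) x a + B.dsmear (cross3 c a) x b
      = (\<Sum>\<alpha>\<in>UNIV. B.dsmear (?d *\<^sub>R axis \<alpha> 1) x (axis \<alpha> 1))"
    by (simp only: sum.distrib B.sum_dsmear_axis)
  also have "\<dots> = - P1 (\<lambda>\<phi>. ?d *\<^sub>R dgrad (translate x S) \<phi>)"
  proof (rule B.sum_dsmear)
    show "linear ((*\<^sub>R) ?d)" by (simp add: linear_iff scaleR_add_right)
    \<comment> \<open>Multiples of the full gradient lie in \<open>W1\<close>, as \<open>S\<close>
      is in \<open>W0\<close>.\<close>
    show "(\<lambda>\<phi>. ?d *\<^sub>R dgrad S \<phi>) \<in> W1"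
      using S by (intro B.domain_scaleR grad(1))
  qed
  also have "\<dots> = - (?d *\<^sub>R gr (P0 (translate x S)))"
    using grad[OF W0] by (simp add: B.projection_scaleR)
  finally show ?thesis
    unfolding inner_add_right[symmetric] using inner_gr_eq_0[OF assms] by simp
qed

section \<open>The bracket as a form on differentials and its Hamiltonian vector field\<close>

text \<open>The bracket on differentials: \<open>{F, G}(U) = poisson_form U (\<nabla>F(U)) (\<nabla>G(U))\<close>.\<close>

fun poisson_form ::
  "('n, 'v1, 'v2) state \<Rightarrow> ('n, 'v1, 'v2) state \<Rightarrow> ('n, 'v1, 'v2) state \<Rightarrow> real" where
  "poisson_form (X, V, E, B) (aX, aV, aE, aB) (bX, bV, bE, bB) =
    (\<Sum>p\<in>UNIV. 1 / m p * (aX $ p \<bullet> bV $ p - aV $ p \<bullet> bX $ p)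
      + q p / (m p)\<^sup>2 * (B \<bullet> B.smear (cross3 (aV $ p) (bV $ p)) (X $ p))
      + q p / m p * (E.smear (aV $ p) (X $ p) \<bullet> bE - aE \<bullet> E.smear (bV $ p) (X $ p)))
    + (aE \<bullet> cu bB - cu aB \<bullet> bE)"

text \<open>The coefficients of the form depend on positions and magnetic field only. Hence the
  canonical and curl terms leave no trace here, and the velocity and electric components of the
  direction do not occur.\<close>

fun dpoisson_form ::
  "('n, 'v1, 'v2) state \<Rightarrow> ('n, 'v1, 'v2) state \<Rightarrow> ('n, 'v1, 'v2) state \<Rightarrow>
   ('n, 'v1, 'v2) state \<Rightarrow> real" where
  "dpoisson_form (X, V, E, B) (wX, wV, wE, wB) (aX, aV, aE, aB) (bX, bV, bE, bB) =
    (\<Sum>p\<in>UNIV. q p / (m p)\<^sup>2 * (wB \<bullet> B.smear (cross3 (aV $ p) (bV $ p)) (X $ p)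
          + B \<bullet> B.dsmear (cross3 (aV $ p) (bV $ p)) (X $ p) (wX $ p))
      + q p / m p * (E.dsmear (aV $ p) (X $ p) (wX $ p) \<bullet> bE
          - aE \<bullet> E.dsmear (bV $ p) (X $ p) (wX $ p)))"

text \<open>Obtained by solving the form for its first covector: the coupling fields arise as
  adjoints of smearing, \<open>curl_weak\<close> as the adjoint of \<open>cu\<close>.\<close>

fun hamiltonian_field ::
  "('n, 'v1, 'v2) state \<Rightarrow> ('n, 'v1, 'v2) state \<Rightarrow> ('n, 'v1, 'v2) state" where
  "hamiltonian_field (X, V, E, B) (bX, bV, bE, bB) =
    ((\<chi> p. (1 / m p) *\<^sub>R bV $ p),
     (\<chi> p. (q p / m p) *\<^sub>R coupling_field \<Omega> \<iota>2 P2 S bE (X $ p)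
        + (q p / (m p)\<^sup>2) *\<^sub>R cross3 (bV $ p) (coupling_field \<Omega> \<iota>1 P1 S B (X $ p))
        - (1 / m p) *\<^sub>R bX $ p),
     cu bB - (\<Sum>p\<in>UNIV. (q p / m p) *\<^sub>R E.smear (bV $ p) (X $ p)),
     - curl_weak \<Omega> \<iota>1 \<iota>2 cu bE)"

lemma poisson_form_skew: "poisson_form U a b = - poisson_form U b a"
proof -
  obtain X V E B where U: "U = (X, V, E, B)" by (cases U)
  obtain aX aV aE aB where a: "a = (aX, aV, aE, aB)" by (cases a)
  obtain bX bV bE bB where b: "b = (bX, bV, bE, bB)" by (cases b)
  have skew: "B \<bullet> B.smear (cross3 v w) x = - (B \<bullet> B.smear (cross3 w v) x)" for v w x
    unfolding cross_skew[of v w] linear_neg[OF B.linear_smear] by simp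
  have "1 / m p * (aX $ p \<bullet> bV $ p - aV $ p \<bullet> bX $ p)
      + q p / (m p)\<^sup>2 * (B \<bullet> B.smear (cross3 (aV $ p) (bV $ p)) (X $ p))
      + q p / m p * (E.smear (aV $ p) (X $ p) \<bullet> bE - aE \<bullet> E.smear (bV $ p) (X $ p))
    = - (1 / m p * (bX $ p \<bullet> aV $ p - bV $ p \<bullet> aX $ p)
      + q p / (m p)\<^sup>2 * (B \<bullet> B.smear (cross3 (bV $ p) (aV $ p)) (X $ p))
      + q p / m p * (E.smear (bV $ p) (X $ p) \<bullet> aE - bE \<bullet> E.smear (aV $ p) (X $ p)))" for p
    by (simp add: skew[of "aV $ p" "bV $ p"] inner_commute right_diff_distrib)
  then have "poisson_form U a b = - (poisson_form U b a - (bE \<bullet> cu aB - cu bB \<bullet> aE))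
      + (aE \<bullet> cu bB - cu aB \<bullet> bE)"
    unfolding U a b poisson_form.simps by (simp only: sum_negf add_diff_cancel_right')
  then show ?thesis
    by (simp add: inner_commute)
qed

lemma poisson_form_eq_inner: "poisson_form U a b = a \<bullet> hamiltonian_field U b"
proof -
  obtain X V E B where U: "U = (X, V, E, B)" by (cases U)
  obtain aX aV aE aB where a: "a = (aX, aV, aE, aB)" by (cases a)
  obtain bX bV bE bB where b: "b = (bX, bV, bE, bB)" by (cases b)
  \<comment> \<open>The magnetic force is dual to smearing the cross product, by cyclic invariance
    of the triple product.\<close>
  have BS: "v \<bullet> cross3 w (coupling_field \<Omega> \<iota>1 P1 S B x) = B \<bullet> B.smear (cross3 v w) x" for v w x
    unfolding B.coupling_field_inner[symmetric] by (rule inner_cross_cyclic[symmetric])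
  have ES: "v \<bullet> coupling_field \<Omega> \<iota>2 P2 S bE x = E.smear v x \<bullet> bE" for v x
    using E.coupling_field_inner by (simp add: inner_commute)
  show ?thesis
    unfolding U a b poisson_form.simps hamiltonian_field.simps inner_Pair
      inner_vec_def[where 'a = "real^3"]
    by (simp add: inner_add_right inner_diff_right inner_sum_right BS ES
        inner_commute[of aB] curl_weak_cu inner_commute[of bE] sum.distrib sum_subtractf
        algebra_simps)
qed

lemma poisson_form_has_derivative:
  "((\<lambda>U. poisson_form U a b) has_derivative (\<lambda>w. dpoisson_form U w a b)) (at U)"
proof -
  obtain aX aV aE aB where a: "a = (aX, aV, aE, aB)" by (cases a)
  obtain bX bV bE bB where b: "b = (bX, bV, bE, bB)" by (cases b)
  have form: "(\<lambda>U. poisson_form U a b) = (\<lambda>U.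
    (\<Sum>p\<in>UNIV. 1 / m p * (aX $ p \<bullet> bV $ p - aV $ p \<bullet> bX $ p)
      + q p / (m p)\<^sup>2 * (snd (snd (snd U)) \<bullet> B.smear (cross3 (aV $ p) (bV $ p)) (fst U $ p))
      + q p / m p * (E.smear (aV $ p) (fst U $ p) \<bullet> bE - aE \<bullet> E.smear (bV $ p) (fst U $ p)))
    + (aE \<bullet> cu bB - cu aB \<bullet> bE))"
    by (auto simp: a b fun_eq_iff)
  have dform: "(\<lambda>w. dpoisson_form U w a b) = (\<lambda>w.
    (\<Sum>p\<in>UNIV. q p / (m p)\<^sup>2 * (snd (snd (snd U)) \<bullet> B.dsmear (cross3 (aV $ p) (bV $ p)) (fst U $ p) (fst w $ p)
        + snd (snd (snd w)) \<bullet> B.smear (cross3 (aV $ p) (bV $ p)) (fst U $ p))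
      + q p / m p * (E.dsmear (aV $ p) (fst U $ p) (fst w $ p) \<bullet> bE
          - aE \<bullet> E.dsmear (bV $ p) (fst U $ p) (fst w $ p))))"
    by (cases U) (auto simp: a b fun_eq_iff add.commute)
  have X: "((\<lambda>U :: ('n, 'v1, 'v2) state. fst U $ p) has_derivative (\<lambda>w. fst w $ p)) (at U)" for p
    by (intro bounded_linear_imp_has_derivative bounded_linear_compose[OF bounded_linear_vec_nth]
        bounded_linear_fst)
  have B: "((\<lambda>U :: ('n, 'v1, 'v2) state. snd (snd (snd U))) has_derivative (\<lambda>w. snd (snd (snd w)))) (at U)"
    by (intro bounded_linear_imp_has_derivative bounded_linear_snd
        bounded_linear_compose[OF bounded_linear_snd])
  note smear = has_derivative_compose[OF X B.smear_has_derivative]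
    has_derivative_compose[OF X E.smear_has_derivative]
  show ?thesis
    unfolding form dform
    by (rule has_derivative_eq_rhs)
      (rule has_derivative_add has_derivative_sum has_derivative_diff has_derivative_mult_right
        has_derivative_inner has_derivative_const B smear | simp add: fun_eq_iff)+
qed

section \<open>The Jacobi identity\<close>

lemma hamiltonian_field_jacobi:
  assumes U: "U = (X, V, E, B)" and gauss: "div_weak \<Omega> \<iota>0 \<iota>1 gr B = 0"
  shows "dpoisson_form U (hamiltonian_field U c) a b + dpoisson_form U (hamiltonian_field U a) b c
    + dpoisson_form U (hamiltonian_field U b) c a = 0"
proof -
  obtain aX aV aE aB where a: "a = (aX, aV, aE, aB)" by (cases a)
  obtain bX bV bE bB where b: "b = (bX, bV, bE, bB)" by (cases b)
  obtain cX cV cE cB where c: "c = (cX, cV, cE, cB)" by (cases c)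
  \<comment> \<open>Moving the magnetic field by a weak curl produces, through
    \<open>cu_smear\<close>, position derivatives of the electric smearing.\<close>
  have magnetic: "- curl_weak \<Omega> \<iota>1 \<iota>2 cu eE \<bullet> B.smear (cross3 v w) x
      = eE \<bullet> E.dsmear v x w - eE \<bullet> E.dsmear w x v" for eE v w x
    by (simp add: curl_weak_cu cu_smear inner_diff_right)
  \<comment> \<open>The contribution of particle \<open>p\<close>: first the motion of the magnetic
    field, then the motion of the position in the magnetic term and in the electric coupling. The
    position moves by \<open>u\<close> divided by the mass.\<close>
  let ?t = "\<lambda>eE u v w fE gE p. q p / (m p)\<^sup>2 * ((eE \<bullet> E.dsmear v (X $ p) w - eE \<bullet> E.dsmear w (X $ p) v)
      + 1 / m p * (B \<bullet> B.dsmear (cross3 v w) (X $ p) u))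
      + q p / (m p)\<^sup>2 * (gE \<bullet> E.dsmear v (X $ p) u - fE \<bullet> E.dsmear w (X $ p) u)"
  have step: "dpoisson_form U (hamiltonian_field U (eX, eV, eE, eB)) (fX, fV, fE, fB) (gX, gV, gE, gB)
    = (\<Sum>p\<in>UNIV. ?t eE (eV $ p) (fV $ p) (gV $ p) fE gE p)"
    for eX eV eE eB fX fV fE fB gX gV gE gB
    unfolding U hamiltonian_field.simps dpoisson_form.simps magnetic
    by (simp add: linear_cmul[OF E.linear_dsmear] linear_cmul[OF B.linear_dsmear]
        inner_commute[of _ gE] power2_eq_square algebra_simps)
  \<comment> \<open>In the cyclic sum each pairing of an electric component with a derivative
    \<open>E.dsmear\<close> occurs twice, with opposite signs. The three magnetic derivatives remain
    for \<open>gauss_law_dsmear\<close>.\<close>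
  have "?t cE (cV $ p) (aV $ p) (bV $ p) aE bE p + ?t aE (aV $ p) (bV $ p) (cV $ p) bE cE p
     + ?t bE (bV $ p) (cV $ p) (aV $ p) cE aE p
    = q p / (m p)\<^sup>2 * (1 / m p) * (B \<bullet> B.dsmear (cross3 (aV $ p) (bV $ p)) (X $ p) (cV $ p)
        + B \<bullet> B.dsmear (cross3 (bV $ p) (cV $ p)) (X $ p) (aV $ p)
        + B \<bullet> B.dsmear (cross3 (cV $ p) (aV $ p)) (X $ p) (bV $ p))" for p
    by (simp only: distrib_left right_diff_distrib mult.assoc)
  then show ?thesis
    unfolding a b c step sum.distrib[symmetric] by (simp add: gauss_law_dsmear[OF gauss])
qed

text \<open>Asking for differentiability at \<open>U\<close> covers both the smooth functionals and
  the Hamiltonian.\<close>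

lemma vm_bracket_eq_poisson_form:
  assumes "F differentiable (at U)" "G differentiable (at U)"
  shows "vm_bracket \<Omega> \<iota>1 \<iota>2 cu P1 P2 S m q F G U = poisson_form U (gradient F U) (gradient G U)"
proof -
  obtain X V E B where U: "U = (X, V, E, B)" by (cases U)
  obtain fX fV fE fB where f: "gradient F U = (fX, fV, fE, fB)" by (cases "gradient F U")
  obtain gX gV gE gB where g: "gradient G U = (gX, gV, gE, gB)" by (cases "gradient G U")
  note F = delta_gradient[OF gradient_exists[OF finite_dimensional_state assms(1), unfolded f, unfolded U]]
  note G = delta_gradient[OF gradient_exists[OF finite_dimensional_state assms(2), unfolded g, unfolded U]]
  show ?thesis
    unfolding f g unfolding U vm_bracket.simps Let_def F G poisson_form.simps
      discrete_space_integral_diff[OF E.discrete] B.coupling_field_inner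
      E.smear_def[symmetric] B.smear_def[symmetric] ..
qed

section \<open>The semi-discrete equations as a Poisson system\<close>

lemma hamiltonian_gradient:
  "GDERIV (hamiltonian \<Omega> \<iota>1 \<iota>2 m) (X, V, E, B) :> (0, (\<chi> p. m p *\<^sub>R V $ p), E, B)"
proof -
  \<comment> \<open>The integrals are inner products of the discrete spaces, so the Hamiltonian is a
    quadratic polynomial in the components of the state.\<close>
  have H: "hamiltonian \<Omega> \<iota>1 \<iota>2 m = (\<lambda>U. (\<Sum>p\<in>UNIV. m p / 2 * (fst (snd U) $ p \<bullet> fst (snd U) $ p))
      + 1 / 2 * (fst (snd (snd U)) \<bullet> fst (snd (snd U)))
      + 1 / 2 * (snd (snd (snd U)) \<bullet> snd (snd (snd U))))"
    by (auto simp: fun_eq_iff power2_norm_eq_inner discrete_space_integral_inner[OF E.discrete]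
        discrete_space_integral_inner[OF B.discrete])
  let ?U = "(X, V, E, B)"
  have V: "((\<lambda>U :: ('n, 'v1, 'v2) state. fst (snd U) $ p) has_derivative (\<lambda>w. fst (snd w) $ p)) (at ?U)" for p
    by (intro bounded_linear_imp_has_derivative bounded_linear_compose[OF bounded_linear_vec_nth]
        bounded_linear_compose[OF bounded_linear_fst] bounded_linear_snd)
  have E: "((\<lambda>U :: ('n, 'v1, 'v2) state. fst (snd (snd U))) has_derivative (\<lambda>w. fst (snd (snd w)))) (at ?U)"
    by (intro bounded_linear_imp_has_derivative bounded_linear_snd
        bounded_linear_compose[OF bounded_linear_snd] bounded_linear_compose[OF bounded_linear_fst])
  have B: "((\<lambda>U :: ('n, 'v1, 'v2) state. snd (snd (snd U))) has_derivative (\<lambda>w. snd (snd (snd w)))) (at ?U)"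
    by (intro bounded_linear_imp_has_derivative bounded_linear_snd
        bounded_linear_compose[OF bounded_linear_snd])
  show ?thesis
    unfolding gderiv_def H
    by (rule has_derivative_eq_rhs)
      (rule has_derivative_add has_derivative_sum has_derivative_mult_right
        has_derivative_inner V E B
       | auto simp: fun_eq_iff inner_vec_def[where 'a = "real^3"] inner_commute intro!: sum.cong)+
qed

lemma semi_discrete_at_iff:
  "semi_discrete_at \<Omega> \<iota>1 \<iota>2 cu P1 P2 S m q I X V E B t \<longleftrightarrow>
    ((\<lambda>s. (X s, V s, E s, B s)) has_vector_derivative
      hamiltonian_field (X t, V t, E t, B t)
        (gradient (hamiltonian \<Omega> \<iota>1 \<iota>2 m) (X t, V t, E t, B t))) (at t within I)"
proof -
  have E': "- E' + cu (B t) = (\<Sum>p\<in>UNIV. q p *\<^sub>R E.smear (V t $ p) (X t $ p)) \<longleftrightarrow>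
      E' = cu (B t) - (\<Sum>p\<in>UNIV. q p *\<^sub>R E.smear (V t $ p) (X t $ p))" for E'
    by (auto simp: algebra_simps)
  have B': "B' + curl_weak \<Omega> \<iota>1 \<iota>2 cu (E t) = 0 \<longleftrightarrow> B' = - curl_weak \<Omega> \<iota>1 \<iota>2 cu (E t)" for B'
    by (rule eq_neg_iff_add_eq_0[symmetric])
  \<comment> \<open>The velocity gradient of the Hamiltonian carries a factor \<open>m p\<close>. It
    cancels the mass in the position equation and one of the two masses in the magnetic
    force.\<close>
  have field: "hamiltonian_field (X t, V t, E t, B t)
        (gradient (hamiltonian \<Omega> \<iota>1 \<iota>2 m) (X t, V t, E t, B t))
    = ((\<chi> p. V t $ p),
       (\<chi> p. (q p / m p) *\<^sub>R (coupling_field \<Omega> \<iota>2 P2 S (E t) (X t $ p)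
          + cross3 (V t $ p) (coupling_field \<Omega> \<iota>1 P1 S (B t) (X t $ p)))),
       cu (B t) - (\<Sum>p\<in>UNIV. q p *\<^sub>R E.smear (V t $ p) (X t $ p)),
       - curl_weak \<Omega> \<iota>1 \<iota>2 cu (E t))"
    unfolding gradient_eqI[OF hamiltonian_gradient] hamiltonian_field.simps
    using mass_nonzero
    by (simp add: vec_eq_iff cross_mult_left linear_cmul[OF E.linear_smear] power2_eq_square
        scaleR_add_right)
  show ?thesis
    unfolding field has_vector_derivative_Pair_iff has_vector_derivative_vec_iff
      semi_discrete_at_def E.smear_def[symmetric] E' B'
    by auto
qed

text \<open>The Gauss law enters through the Jacobi identity alone; the structure matrix, its
  skewness and its derivatives are available at every state.\<close>

theorem poisson_bracket_for_vm_bracket: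
  fixes \<Phi> :: "real^'d::finite \<Rightarrow> ('n, 'v1, 'v2) state"
  assumes "linear \<Phi>" "bij \<Phi>"
  shows "poisson_bracket_for \<Phi> {(X, V, E, B). div_weak \<Omega> \<iota>0 \<iota>1 gr B = 0}
    (vm_bracket \<Omega> \<iota>1 \<iota>2 cu P1 P2 S m q)"
  using finite_dimensional_state assms
proof (rule poisson_bracket_for_formI)
  show "vm_bracket \<Omega> \<iota>1 \<iota>2 cu P1 P2 S m q F G U = poisson_form U (gradient F U) (gradient G U)"
    if "smooth_fun F" "smooth_fun G" for F G U
    using that by (intro vm_bracket_eq_poisson_form smooth_fun_differentiable)
  show "dpoisson_form U (hamiltonian_field U c) a b + dpoisson_form U (hamiltonian_field U a) b c
      + dpoisson_form U (hamiltonian_field U b) c a = 0"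
    if "U \<in> {(X, V, E, B). div_weak \<Omega> \<iota>0 \<iota>1 gr B = 0}" for U a b c
    using that by (auto intro: hamiltonian_field_jacobi)
qed (rule poisson_form_skew poisson_form_eq_inner poisson_form_has_derivative)+

text \<open>The bracket with the Hamiltonian pairs the gradient of \<open>F\<close> with the
  Hamiltonian field. Holding for all smooth \<open>F\<close>, the evolution equation says exactly
  that the curve has this field as velocity.\<close>

theorem semi_discrete_iff_poisson_system:
  "semi_discrete_at \<Omega> \<iota>1 \<iota>2 cu P1 P2 S m q I X V E B t \<longleftrightarrow>
    (\<forall>F. smooth_fun F \<longrightarrow> ((\<lambda>s. F (X s, V s, E s, B s)) has_real_derivative
      vm_bracket \<Omega> \<iota>1 \<iota>2 cu P1 P2 S m q F (hamiltonian \<Omega> \<iota>1 \<iota>2 m) (X t, V t, E t, B t))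
        (at t within I))"
proof -
  let ?H = "hamiltonian \<Omega> \<iota>1 \<iota>2 m" and ?U = "(X t, V t, E t, B t)"
  have "?H differentiable (at ?U)"
    using hamiltonian_gradient unfolding gderiv_def differentiable_def by blast
  then have "vm_bracket \<Omega> \<iota>1 \<iota>2 cu P1 P2 S m q F ?H ?U
      = gradient F ?U \<bullet> hamiltonian_field ?U (gradient ?H ?U)" if "smooth_fun F" for F
    using that
    by (simp only: vm_bracket_eq_poisson_form smooth_fun_differentiable poisson_form_eq_inner)
  then show ?thesis
    unfolding semi_discrete_at_iff has_vector_derivative_iff_smooth[OF finite_dimensional_state]
    by (intro iff_allI imp_cong refl) (simp only:)
qed

end

theorem theorem1:
  fixes \<Omega> :: "(real^3) set"
    and \<iota>0 :: "'v0::real_inner \<Rightarrow> real^3 \<Rightarrow> real"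
    and \<iota>1 :: "'v1::real_inner \<Rightarrow> real^3 \<Rightarrow> real^3"
    and \<iota>2 :: "'v2::real_inner \<Rightarrow> real^3 \<Rightarrow> real^3"
    and \<iota>3 :: "'v3::real_inner \<Rightarrow> real^3 \<Rightarrow> real"
    and gr :: "'v0 \<Rightarrow> 'v1" and cu :: "'v1 \<Rightarrow> 'v2" and di :: "'v2 \<Rightarrow> 'v3"
    and W0 W3 :: "real distr set" and W1 W2 :: "(real^3) distr set"
    and P0 :: "real distr \<Rightarrow> 'v0" and P1 :: "(real^3) distr \<Rightarrow> 'v1"
    and P2 :: "(real^3) distr \<Rightarrow> 'v2" and P3 :: "real distr \<Rightarrow> 'v3"
    and S :: "real distr"
    and m q :: "'n::finite \<Rightarrow> real"
  defines "br \<equiv> vm_bracket \<Omega> \<iota>1 \<iota>2 cu P1 P2 S m q"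
    and "H \<equiv> hamiltonian \<Omega> \<iota>1 \<iota>2 m"
  assumes "discrete_de_rham \<Omega> \<iota>0 \<iota>1 \<iota>2 \<iota>3 gr cu di"
    and "commuting_projections \<Omega> \<iota>0 \<iota>1 \<iota>2 \<iota>3 gr cu di W0 W1 W2 W3 P0 P1 P2 P3"
    and "admissible_shape W0 W1 W2 W3 S"
    and "differentiable_in_position W1 P1 S"
    and "differentiable_in_position W2 P2 S"
    and "\<And>p. m p \<noteq> 0"
  shows "(\<forall>\<Phi> :: real^'d::finite \<Rightarrow> ('n, 'v1, 'v2) state. linear \<Phi> \<and> bij \<Phi> \<longrightarrow>
            poisson_bracket_for \<Phi> {(X, V, E, B). div_weak \<Omega> \<iota>0 \<iota>1 gr B = 0} br)
       \<and> (\<forall>I X V E B. is_interval I \<longrightarrow>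
            (\<forall>t\<in>I. semi_discrete_at \<Omega> \<iota>1 \<iota>2 cu P1 P2 S m q I X V E B t) \<longleftrightarrow>
            (\<forall>F. smooth_fun F \<longrightarrow> (\<forall>t\<in>I.
               ((\<lambda>s. F (X s, V s, E s, B s)) has_real_derivative
                  br F H (X t, V t, E t, B t)) (at t within I))))"
proof -
  interpret structure_preserving_particles \<Omega> \<iota>0 \<iota>1 \<iota>2 \<iota>3 gr cu di W0 W3 W1 W2 P0 P1 P2 P3 S m q
    by unfold_locales fact+
  show ?thesis
    unfolding br_def H_def using poisson_bracket_for_vm_bracket
    by (auto simp only: semi_discrete_iff_poisson_system)
qed

end
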